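(* Let $\mathcal P$ be a primitive integral square packing such that either every curvature in $\mathcal P$ is congruent to $1$ modulo $8$, or $\mathcal P$ contains circles of both odd and even curvature. For tangent circles $\mathcal C,\mathcal C'$ of $\mathcal P$ with curvatures $a\neq0$ and $b$ satisfying $\gcd(a,b)=1$, put $\rho=a+b$ and $$\chi(\mathcal C,\mathcal C')=\begin{cases}\left(\frac{\rho}{a}\right) & a\equiv 0,1,4\pmod 8,\\ -\left(\frac{\rho}{a}\right) & a\equiv 2,6,7\pmod 8,\\ (-1)^{\rho}\left(\frac{\rho}{a}\right) & a\equiv 3\pmod 8,\\ (-1)^{\rho+1}\left(\frac{\rho}{a}\right) & a\equiv 5\pmod 8.\end{cases}$$ Suppose $\chi(\mathcal C,\mathcal C')=-1$ for every such pair. Then no circle of $\mathcal P$ has curvature of the form $n^2$ with $n$ an integer.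
   Context: Generalized circles are circles and lines in the extended plane; each circle of a packing has signed curvature: $0$ for a line, $1/r$ for a circle of radius $r$, and $-1/r$ for a circle containing all other circles of the packing. A square-grid configuration is the image under a Möbius transformation $\mu$ of the family of circles of radius $1$ centered at $(2i,2j)$, $i,j\in\mathbb Z$ (tangency graph: the square grid); its dual circles are the $\mu$-images of the circles of radius $1$ centered at $(2i+1,2j+1)$. The square Apollonian group is generated by the inversions in the dual circles, and the square packing is the union of the orbit of the configuration. The packing is integral if all curvatures are integers and primitive if their gcd is $1$. $\left(\frac{m}{n}\right)$ is the Kronecker symbol: Legendre symbol for $n$ an odd prime; $\left(\frac m2\right)=0,1,-1$ according as $m$ is even, $\equiv\pm1$, or $\equiv\pm3\pmod 8$; $\left(\frac m{-1}\right)=1$ if $m\ge0$, $-1$ if $m<0$; $\left(\frac m1\right)=1$; multiplicative in $n$. *)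

theory Defs
  imports "HOL-Analysis.Analysis" "HOL-Number_Theory.Residues"
begin

text \<open>
  The extended plane is \<open>complex option\<close>, with \<open>None\<close> as the point at infinity (the same encoding as
  the library's Alexandroff compactification). Generalized circles are sets of its points, so that
  maps of the extended plane act on them by taking images.
\<close>

type_synonym ext_plane = "complex option"

definition ext_circle :: "complex \<Rightarrow> real \<Rightarrow> ext_plane set" where
  "ext_circle c r = Some ` sphere c r"

definition ext_line :: "complex \<Rightarrow> complex \<Rightarrow> ext_plane set" where
  "ext_line p u = insert None (Some ` range (\<lambda>t. p + complex_of_real t * u))"

definition moebius :: "complex \<Rightarrow> complex \<Rightarrow> complex \<Rightarrow> complex \<Rightarrow> ext_plane \<Rightarrow> ext_plane" where
  "moebius a b c d x =
     (case x of
        None \<Rightarrow> if c = 0 then None else Some (a / c)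
      | Some z \<Rightarrow> if c * z + d = 0 then None else Some ((a * z + b) / (c * z + d)))"

definition is_moebius :: "(ext_plane \<Rightarrow> ext_plane) \<Rightarrow> bool" where
  "is_moebius \<mu> \<longleftrightarrow> (\<exists>a b c d. a * d - b * c \<noteq> 0 \<and> \<mu> = moebius a b c d)"

definition circle_inversion :: "complex \<Rightarrow> real \<Rightarrow> ext_plane \<Rightarrow> ext_plane" where
  "circle_inversion c r x =
     (case x of
        None \<Rightarrow> Some c
      | Some z \<Rightarrow> if z = c then None else Some (c + complex_of_real (r\<^sup>2) / cnj (z - c)))"

definition line_reflection :: "complex \<Rightarrow> complex \<Rightarrow> ext_plane \<Rightarrow> ext_plane" where
  "line_reflection p u = map_option (\<lambda>z. p + u / cnj u * cnj (z - p))"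

definition is_inversion_in :: "ext_plane set \<Rightarrow> (ext_plane \<Rightarrow> ext_plane) \<Rightarrow> bool" where
  "is_inversion_in D \<sigma> \<longleftrightarrow>
     (\<exists>c r. r > 0 \<and> D = ext_circle c r \<and> \<sigma> = circle_inversion c r) \<or>
     (\<exists>p u. u \<noteq> 0 \<and> D = ext_line p u \<and> \<sigma> = line_reflection p u)"

definition square_configuration :: "(ext_plane \<Rightarrow> ext_plane) \<Rightarrow> ext_plane set set" where
  "square_configuration \<mu> =
     {\<mu> ` ext_circle (Complex (of_int (2 * i)) (of_int (2 * j))) 1 | i j :: int. True}"

definition dual_circles :: "(ext_plane \<Rightarrow> ext_plane) \<Rightarrow> ext_plane set set" where
  "dual_circles \<mu> =
     {\<mu> ` ext_circle (Complex (of_int (2 * i + 1)) (of_int (2 * j + 1))) 1 | i j :: int. True}"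

inductive_set square_apollonian_group ::
  "(ext_plane \<Rightarrow> ext_plane) \<Rightarrow> (ext_plane \<Rightarrow> ext_plane) set"
  for \<mu> :: "ext_plane \<Rightarrow> ext_plane" where
  generator: "D \<in> dual_circles \<mu> \<Longrightarrow> is_inversion_in D \<sigma> \<Longrightarrow> \<sigma> \<in> square_apollonian_group \<mu>"
| identity: "id \<in> square_apollonian_group \<mu>"
| composition: "g \<in> square_apollonian_group \<mu> \<Longrightarrow> h \<in> square_apollonian_group \<mu> \<Longrightarrow>
    g \<circ> h \<in> square_apollonian_group \<mu>"
| inverse: "g \<in> square_apollonian_group \<mu> \<Longrightarrow> inv_into UNIV g \<in> square_apollonian_group \<mu>"

definition square_packing_of :: "(ext_plane \<Rightarrow> ext_plane) \<Rightarrow> ext_plane set set" where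
  "square_packing_of \<mu> =
     {g ` C | g C. g \<in> square_apollonian_group \<mu> \<and> C \<in> square_configuration \<mu>}"

definition is_square_packing :: "ext_plane set set \<Rightarrow> bool" where
  "is_square_packing P \<longleftrightarrow> (\<exists>\<mu>. is_moebius \<mu> \<and> P = square_packing_of \<mu>)"

text \<open>
  The signed curvature depends on the packing, because the sign does. It is meant only for
  generalized circles; those that are not circles are lines and receive \<open>0\<close>.
\<close>

definition curvature :: "ext_plane set set \<Rightarrow> ext_plane set \<Rightarrow> real" where
  "curvature P C =
     (if \<exists>c r. r > 0 \<and> C = ext_circle c r then
        (let (c, r) = (THE (c, r). r > 0 \<and> C = ext_circle c r)
         in if \<forall>C'\<in>P. C' \<subseteq> Some ` cball c r then - 1 / r else 1 / r)
      else 0)"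

definition is_integral_packing :: "ext_plane set set \<Rightarrow> bool" where
  "is_integral_packing P \<longleftrightarrow> (\<forall>C\<in>P. curvature P C \<in> \<int>)"

definition curvatures :: "ext_plane set set \<Rightarrow> int set" where
  "curvatures P = {k. \<exists>C\<in>P. curvature P C = of_int k}"

definition is_primitive_packing :: "ext_plane set set \<Rightarrow> bool" where
  "is_primitive_packing P \<longleftrightarrow> Gcd (curvatures P) = 1"

text \<open>Parallel lines are tangent at infinity.\<close>

definition tangent :: "ext_plane set \<Rightarrow> ext_plane set \<Rightarrow> bool" where
  "tangent C C' \<longleftrightarrow> (\<exists>x. C \<inter> C' = {x})"

definition kronecker_prime :: "int \<Rightarrow> int \<Rightarrow> int" where
  "kronecker_prime m p =
     (if p = 2 then (if even m then 0 else if m mod 8 \<in> {1, 7} then 1 else - 1)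
      else Legendre m p)"

text \<open>
  The product below extends the symbol multiplicatively from primes, \<open>1\<close> and \<open>- 1\<close> to all nonzero
  \<open>n\<close>; the value at \<open>n = 0\<close> is the usual convention.
\<close>

definition kronecker :: "int \<Rightarrow> int \<Rightarrow> int" where
  "kronecker m n =
     (if n = 0 then (if \<bar>m\<bar> = 1 then 1 else 0)
      else (if n < 0 \<and> m < 0 then - 1 else 1) *
           (\<Prod>p\<in>prime_factors n. kronecker_prime m p ^ multiplicity p n))"

text \<open>
  The invariant of a pair of tangent circles depends only on their curvatures \<open>a\<close> and \<open>b\<close>.
\<close>

definition chi :: "int \<Rightarrow> int \<Rightarrow> int" where
  "chi a b =
     (let \<rho> = a + b in
      if a mod 8 \<in> {0, 1, 4} then kronecker \<rho> a
      else if a mod 8 \<in> {2, 6, 7} then - kronecker \<rho> a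
      else if a mod 8 = 3 then (- 1) ^ nat \<bar>\<rho>\<bar> * kronecker \<rho> a
      else (- 1) ^ nat \<bar>\<rho> + 1\<bar> * kronecker \<rho> a)"

end

theory Submission
  imports Defs
begin

text \<open>
  If some tangent pair has coprime curvatures \<open>n\<^sup>2 \<noteq> 0\<close> and \<open>b\<close>, then its invariant is the Kronecker symbol
  over the square \<open>n\<^sup>2\<close>, hence \<open>1\<close>. So it is enough to find, for each circle \<open>C\<close> of curvature \<open>A\<close>, a
  tangent circle of coprime curvature; if \<open>A = 0\<close>, that circle has curvature \<open>1\<close> because a packing with a
  line has no negative curvature, and the roles of the two circles are exchanged. Coprimality does not
  see signs, so only absolute values of curvatures matter and disjointness of the circles is not needed.

  The circles of the packing tangent to \<open>C\<close> are permuted by the inversions in the dual circles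
  orthogonal to \<open>C\<close>. In terms of \<open>\<rho> = A + b\<close>, half of them are the values of a binary quadratic form
  \<open>P x\<^sup>2 + 2 K x y + R y\<^sup>2\<close> with \<open>P R - K\<^sup>2 = 4 A\<^sup>2\<close> at coprime \<open>x, y\<close> of different parity, the inversions
  acting as the steps of Euclid's algorithm with even quotients. The other half belong to a second such
  form. If a prime divided \<open>A\<close> and all coefficients, it would divide all curvatures of the packing,
  since these are integral combinations of the curvatures of \<open>C\<close> and four neighbours. Hence one of the
  two forms takes a value prime to \<open>A\<close>.
\<close>

section \<open>Circles and inversions in Hermitian coordinates\<close>

text \<open>The zero set of a Hermitian form. Under the normalization
  \<open>|\<gamma>|\<^sup>2 - \<alpha> \<beta> = 1\<close> it is the circle with centre
  \<open>\<gamma> / \<alpha>\<close> and radius \<open>1 / |\<alpha>|\<close>, or a line if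
  \<open>\<alpha> = 0\<close>; so \<open>\<alpha>\<close> is the curvature up to sign.\<close>

definition circ :: "real \<Rightarrow> real \<Rightarrow> complex \<Rightarrow> ext_plane set" where
  "circ \<alpha> \<beta> \<gamma> = {x. case x of None \<Rightarrow> \<alpha> = 0
     | Some z \<Rightarrow> of_real \<alpha> * (z * cnj z) - cnj \<gamma> * z - \<gamma> * cnj z + of_real \<beta> = 0}"

text \<open>
  The map below is the inversion in the circle with the same coordinates when these are normalized by
  \<open>|\<gamma>|\<^sup>2 - \<alpha> \<beta> = 1\<close>: then its matrix \<open>N\<close> satisfies \<open>N * cnj N = 1\<close>. Circles are handled as fixed
  point sets of these maps, so that the action on circles becomes conjugation of matrices.
\<close>

definition hinv :: "real \<Rightarrow> real \<Rightarrow> complex \<Rightarrow> ext_plane \<Rightarrow> ext_plane" where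
  "hinv \<alpha> \<beta> \<gamma> = moebius \<gamma> (- of_real \<beta>) (of_real \<alpha>) (- cnj \<gamma>) \<circ> map_option cnj"

section \<open>Moebius maps and inversions acting on circles\<close>

lemma moebius_comp:
  assumes "a * d - b * c \<noteq> 0" "a' * d' - b' * c' \<noteq> 0"
  shows "moebius a b c d \<circ> moebius a' b' c' d' =
    moebius (a * a' + b * c') (a * b' + b * d') (c * a' + d * c') (c * b' + d * d')"
proof
  fix x
  show "(moebius a b c d \<circ> moebius a' b' c' d') x =
    moebius (a * a' + b * c') (a * b' + b * d') (c * a' + d * c') (c * b' + d * d') x"
  proof (cases x)
    case None
    show ?thesis
    proof (cases "c' = 0")
      case True
      then show ?thesis using None assms by (auto simp: moebius_def)
    next
      case False
      have "c * (a' / c') + d = (c * a' + d * c') / c'" "a * (a' / c') + b = (a * a' + b * c') / c'"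
        using False by (auto simp: field_simps)
      then show ?thesis using None False by (auto simp: moebius_def)
    qed
  next
    case (Some z)
    have *: "(c * a' + d * c') * z + (c * b' + d * d') = c * (a' * z + b') + d * (c' * z + d')"
      "(a * a' + b * c') * z + (a * b' + b * d') = a * (a' * z + b') + b * (c' * z + d')"
      by (auto simp: algebra_simps)
    have gen: "u * (v / w) + y = (u * v + y * w) / w" if "w \<noteq> 0" for u v w y :: complex
      using that by (simp add: field_simps)
    show ?thesis
    proof (cases "c' * z + d' = 0")
      case True
      have "a' * z + b' \<noteq> 0"
      proof
        assume 0: "a' * z + b' = 0"
        have "a' * d' - b' * c' = a' * (c' * z + d') - c' * (a' * z + b')" by (simp add: algebra_simps)
        with True 0 assms show False by simp
      qed
      then show ?thesis using Some True unfolding comp_def moebius_def by (simp add: *)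
    next
      case False
      have "c * ((a' * z + b') / (c' * z + d')) + d = (c * (a' * z + b') + d * (c' * z + d')) / (c' * z + d')"
        "a * ((a' * z + b') / (c' * z + d')) + b = (a * (a' * z + b') + b * (c' * z + d')) / (c' * z + d')"
        using gen[OF False] by (simp_all only:)
      then show ?thesis using Some False unfolding comp_def moebius_def by (simp add: *)
    qed
  qed
qed

lemma moebius_cnj:
  "map_option cnj \<circ> moebius a b c d = moebius (cnj a) (cnj b) (cnj c) (cnj d) \<circ> map_option cnj"
proof
  fix x
  have "cnj c * cnj z + cnj d = 0 \<longleftrightarrow> c * z + d = 0" for z
    by (metis complex_cnj_add complex_cnj_mult complex_cnj_zero_iff)
  then show "(map_option cnj \<circ> moebius a b c d) x = (moebius (cnj a) (cnj b) (cnj c) (cnj d) \<circ> map_option cnj) x"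
    by (cases x) (auto simp: moebius_def)
qed

lemma moebius_scale:
  assumes "k \<noteq> 0" shows "moebius (k * a) (k * b) (k * c) (k * d) = moebius a b c d"
proof
  fix x
  have *: "k * u * z + k * v = k * (u * z + v)" for u v z by (simp add: algebra_simps)
  show "moebius (k * a) (k * b) (k * c) (k * d) x = moebius a b c d x"
    by (cases x) (auto simp: moebius_def assms *)
qed

lemma moebius_id: "moebius 1 0 0 1 = id"
  by (auto simp: moebius_def fun_eq_iff split: option.splits)

lemma bij_moebius:
  assumes "a * d - b * c \<noteq> 0" shows "bij (moebius a b c d)"
proof -
  have inv: "d * a - (- b) * (- c) \<noteq> 0" using assms by (simp add: algebra_simps)
  have 1: "moebius a b c d \<circ> moebius d (- b) (- c) a = id"
    using moebius_comp[OF assms inv] moebius_scale[OF assms, of 1 0 0 1]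
    by (simp add: moebius_id algebra_simps)
  have 2: "moebius d (- b) (- c) a \<circ> moebius a b c d = id"
    using moebius_comp[OF inv assms] moebius_scale[OF assms, of 1 0 0 1]
    by (simp add: moebius_id algebra_simps)
  show ?thesis using o_bij[OF 2 1] .
qed

lemma norm_sq_cnj: "(norm \<gamma>)\<^sup>2 - \<alpha> * \<beta> = 1 \<longleftrightarrow> \<gamma> * cnj \<gamma> = of_real \<alpha> * of_real \<beta> + 1"
proof -
  have "\<gamma> * cnj \<gamma> = of_real ((norm \<gamma>)\<^sup>2)" by (simp only: complex_norm_square)
  moreover have "of_real \<alpha> * of_real \<beta> + 1 = (of_real (\<alpha> * \<beta> + 1) :: complex)" by simp
  ultimately have "\<gamma> * cnj \<gamma> = of_real \<alpha> * of_real \<beta> + 1 \<longleftrightarrow> (norm \<gamma>)\<^sup>2 = \<alpha> * \<beta> + 1"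
    by (simp only: of_real_eq_iff)
  then show ?thesis by auto
qed

lemma circ_eq_fixpoints:
  assumes "(norm \<gamma>)\<^sup>2 - \<alpha> * \<beta> = 1"
  shows "circ \<alpha> \<beta> \<gamma> = {x. hinv \<alpha> \<beta> \<gamma> x = x}"
proof -
  have g: "\<gamma> * cnj \<gamma> = of_real \<alpha> * of_real \<beta> + 1" using assms norm_sq_cnj by simp
  have "x \<in> circ \<alpha> \<beta> \<gamma> \<longleftrightarrow> hinv \<alpha> \<beta> \<gamma> x = x" for x
  proof (cases x)
    case None
    then show ?thesis by (simp add: circ_def hinv_def moebius_def)
  next
    case (Some z)
    show ?thesis
    proof (cases "of_real \<alpha> * cnj z - cnj \<gamma> = 0")
      case True
      \<comment> \<open>A vanishing denominator means that the inversion sends \<open>z\<close> to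
        infinity. Then \<open>\<alpha>\<close> times the equation of the circle evaluates to
        \<open>- 1\<close>, so \<open>z\<close> does not lie on the circle.\<close>
      have "of_real \<alpha> * (of_real \<alpha> * (z * cnj z) - cnj \<gamma> * z - \<gamma> * cnj z + of_real \<beta>)
          = of_real \<alpha> * z * (of_real \<alpha> * cnj z - cnj \<gamma>) - \<gamma> * (of_real \<alpha> * cnj z - cnj \<gamma>) - 1"
        using g by (simp add: algebra_simps)
      then have "of_real \<alpha> * (z * cnj z) - cnj \<gamma> * z - \<gamma> * cnj z + of_real \<beta> \<noteq> 0"
        using True by auto
      then show ?thesis using Some True by (simp add: circ_def hinv_def moebius_def)
    next
      case False
      then show ?thesis using Some
        by (auto simp: circ_def hinv_def moebius_def field_simps)
    qed
  qed
  then show ?thesis by blast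
qed

lemma image_fixpoints:
  assumes "bij f" "f \<circ> \<sigma> = \<tau> \<circ> f"
  shows "f ` {x. \<sigma> x = x} = {x. \<tau> x = x}"
proof -
  have c: "f (\<sigma> x) = \<tau> (f x)" for x using assms(2) by (metis comp_apply)
  have "x \<in> f ` {x. \<sigma> x = x}" if "\<tau> x = x" for x
  proof -
    obtain y where y: "x = f y" using assms(1) by (metis bij_pointE)
    then have "f (\<sigma> y) = f y" using c that by simp
    then show ?thesis using y assms(1) by (auto dest: bij_is_inj injD)
  qed
  moreover have "\<tau> (f x) = f x" if "\<sigma> x = x" for x using c[of x] that by simp
  ultimately show ?thesis by blast
qed

lemma hinv_comp_hinv:
  assumes "(norm \<gamma>)\<^sup>2 - \<alpha> * \<beta> = 1" "(norm \<gamma>')\<^sup>2 - \<alpha>' * \<beta>' = 1"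
  shows "hinv \<alpha> \<beta> \<gamma> \<circ> hinv \<alpha>' \<beta>' \<gamma>' =
    moebius (\<gamma> * cnj \<gamma>' - of_real \<beta> * of_real \<alpha>') (of_real \<beta> * \<gamma>' - \<gamma> * of_real \<beta>')
      (of_real \<alpha> * cnj \<gamma>' - cnj \<gamma> * of_real \<alpha>') (cnj \<gamma> * \<gamma>' - of_real \<alpha> * of_real \<beta>')"
proof -
  have g: "\<gamma> * cnj \<gamma> = of_real \<alpha> * of_real \<beta> + 1" "\<gamma>' * cnj \<gamma>' = of_real \<alpha>' * of_real \<beta>' + 1"
    using assms norm_sq_cnj by simp_all
  have d: "\<gamma> * - cnj \<gamma> - - of_real \<beta> * of_real \<alpha> \<noteq> 0"
    "cnj \<gamma>' * - \<gamma>' - - of_real \<beta>' * of_real \<alpha>' \<noteq> 0"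
    using g by (auto simp: algebra_simps)
  have cc: "map_option cnj \<circ> map_option cnj = id" by (auto simp: fun_eq_iff option.map_comp comp_def option.map_ident)
  have "hinv \<alpha> \<beta> \<gamma> \<circ> hinv \<alpha>' \<beta>' \<gamma>' =
    moebius \<gamma> (- of_real \<beta>) (of_real \<alpha>) (- cnj \<gamma>) \<circ>
      (map_option cnj \<circ> moebius \<gamma>' (- of_real \<beta>') (of_real \<alpha>') (- cnj \<gamma>')) \<circ> map_option cnj"
    unfolding hinv_def by (simp only: comp_assoc)
  also have "\<dots> = moebius \<gamma> (- of_real \<beta>) (of_real \<alpha>) (- cnj \<gamma>) \<circ>
      moebius (cnj \<gamma>') (- of_real \<beta>') (of_real \<alpha>') (- \<gamma>')"
    by (simp add: moebius_cnj comp_assoc cc)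
  also have "\<dots> = moebius (\<gamma> * cnj \<gamma>' - of_real \<beta> * of_real \<alpha>') (of_real \<beta> * \<gamma>' - \<gamma> * of_real \<beta>')
      (of_real \<alpha> * cnj \<gamma>' - cnj \<gamma> * of_real \<alpha>') (cnj \<gamma> * \<gamma>' - of_real \<alpha> * of_real \<beta>')"
    by (subst moebius_comp[OF d]) (simp add: algebra_simps)
  finally show ?thesis .
qed

lemma hinv_involution:
  assumes "(norm \<gamma>)\<^sup>2 - \<alpha> * \<beta> = 1"
  shows "hinv \<alpha> \<beta> \<gamma> \<circ> hinv \<alpha> \<beta> \<gamma> = id"
proof -
  have g: "\<gamma> * cnj \<gamma> = of_real \<alpha> * of_real \<beta> + 1" using assms norm_sq_cnj by simp
  show ?thesis using g by (simp add: hinv_comp_hinv[OF assms assms] mult.commute moebius_id)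
qed

text \<open>The matrix \<open>N\<close> of the inversion is multiplied by \<open>M\<close> on the
  left and by the inverse of \<open>cnj M\<close> on the right; dividing by the modulus of the
  determinant restores the normalization. Only \<open>\<alpha>'\<close> is made explicit, because it
  carries the curvature of the image.\<close>

lemma moebius_image_circ:
  assumes D: "a * d - b * c \<noteq> 0" and s: "(norm \<gamma>)\<^sup>2 - \<alpha> * \<beta> = 1"
  defines "k \<equiv> norm (a * d - b * c)"
  defines "\<alpha>' \<equiv> ((norm d)\<^sup>2 * \<alpha> + (norm c)\<^sup>2 * \<beta> + 2 * Re (cnj \<gamma> * (d * cnj c))) / k"
  shows "\<exists>\<beta>' \<gamma>'. (norm \<gamma>')\<^sup>2 - \<alpha>' * \<beta>' = 1 \<and>
    moebius a b c d \<circ> hinv \<alpha> \<beta> \<gamma> = hinv \<alpha>' \<beta>' \<gamma>' \<circ> moebius a b c d \<and>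
    moebius a b c d ` circ \<alpha> \<beta> \<gamma> = circ \<alpha>' \<beta>' \<gamma>'"
proof -
  define \<beta>' where "\<beta>' = ((norm a)\<^sup>2 * \<beta> + (norm b)\<^sup>2 * \<alpha> + 2 * Re (a * cnj b * \<gamma>)) / k"
  define \<gamma>' where "\<gamma>' = (a * (\<gamma> * cnj d + of_real \<beta> * cnj c) + b * (of_real \<alpha> * cnj d + cnj \<gamma> * cnj c)) / of_real k"
  have g: "\<gamma> * cnj \<gamma> = of_real \<alpha> * of_real \<beta> + 1" using s norm_sq_cnj by simp
  have k0: "k \<noteq> 0" using D by (simp add: k_def)
  have kk: "of_real k * of_real k = (a * d - b * c) * cnj (a * d - b * c)"
    using complex_norm_square[of "a * d - b * c"] by (simp only: k_def power2_eq_square of_real_mult)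
  have a': "of_real k * of_real \<alpha>' = d * cnj d * of_real \<alpha> + c * cnj c * of_real \<beta> + cnj \<gamma> * (d * cnj c) + \<gamma> * (cnj d * c)"
  proof -
    have "k * \<alpha>' = (norm d)\<^sup>2 * \<alpha> + (norm c)\<^sup>2 * \<beta> + 2 * Re (cnj \<gamma> * (d * cnj c))"
      using k0 by (simp add: \<alpha>'_def)
    then have "of_real (k * \<alpha>') = of_real ((norm d)\<^sup>2) * of_real \<alpha> + of_real ((norm c)\<^sup>2) * of_real \<beta>
        + (of_real (2 * Re (cnj \<gamma> * (d * cnj c))) :: complex)"
      by (metis of_real_add of_real_mult)
    then show ?thesis unfolding complex_norm_square complex_add_cnj[symmetric] by (simp add: algebra_simps)
  qed
  have b': "of_real k * of_real \<beta>' = a * cnj a * of_real \<beta> + b * cnj b * of_real \<alpha> + a * cnj b * \<gamma> + cnj a * b * cnj \<gamma>"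
  proof -
    have "k * \<beta>' = (norm a)\<^sup>2 * \<beta> + (norm b)\<^sup>2 * \<alpha> + 2 * Re (a * cnj b * \<gamma>)"
      using k0 by (simp add: \<beta>'_def)
    then have "of_real (k * \<beta>') = of_real ((norm a)\<^sup>2) * of_real \<beta> + of_real ((norm b)\<^sup>2) * of_real \<alpha>
        + (of_real (2 * Re (a * cnj b * \<gamma>)) :: complex)"
      by (metis of_real_add of_real_mult)
    then show ?thesis unfolding complex_norm_square complex_add_cnj[symmetric] by (simp add: algebra_simps)
  qed
  have g': "of_real k * \<gamma>' = a * (\<gamma> * cnj d + of_real \<beta> * cnj c) + b * (of_real \<alpha> * cnj d + cnj \<gamma> * cnj c)"
    using k0 by (simp add: \<gamma>'_def)
  have g'': "of_real k * cnj \<gamma>' = cnj a * (cnj \<gamma> * d + of_real \<beta> * c) + cnj b * (of_real \<alpha> * d + \<gamma> * c)"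
    using arg_cong[OF g', of cnj] by simp
  have "of_real k * of_real k * (\<gamma>' * cnj \<gamma>' - of_real \<alpha>' * of_real \<beta>')
     = (of_real k * \<gamma>') * (of_real k * cnj \<gamma>') - (of_real k * of_real \<alpha>') * (of_real k * of_real \<beta>')"
    by (simp add: algebra_simps)
  also have "\<dots> = (a * d - b * c) * cnj (a * d - b * c) * (\<gamma> * cnj \<gamma> - of_real \<alpha> * of_real \<beta>)"
    unfolding a' b' g' g'' by (simp add: algebra_simps)
  also have "\<dots> = of_real k * of_real k" using g kk by simp
  finally have "\<gamma>' * cnj \<gamma>' - of_real \<alpha>' * of_real \<beta>' = 1" using k0 by simp
  then have s'': "\<gamma>' * cnj \<gamma>' = of_real \<alpha>' * of_real \<beta>' + 1" by (simp add: algebra_simps)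
  then have s': "(norm \<gamma>')\<^sup>2 - \<alpha>' * \<beta>' = 1" using norm_sq_cnj by simp
  \<comment> \<open>The products \<open>M N\<close> and \<open>N' (cnj M)\<close> agree only up to
    this factor of modulus 1, which does not change the Moebius map.\<close>
  define e where "e = cnj (a * d - b * c) / of_real k"
  have e0: "e \<noteq> 0" using D k0 by (simp add: e_def del: complex_cnj_diff complex_cnj_mult)
  have ek: "of_real k * e = cnj a * cnj d - cnj b * cnj c" using k0 by (simp add: e_def)
  have d1: "\<gamma> * - cnj \<gamma> - - of_real \<beta> * of_real \<alpha> \<noteq> 0" using g by (auto simp: algebra_simps)
  have d2: "\<gamma>' * - cnj \<gamma>' - - of_real \<beta>' * of_real \<alpha>' \<noteq> 0" using s'' by (auto simp: algebra_simps)
  have d3: "cnj a * cnj d - cnj b * cnj c \<noteq> 0" using e0 k0 ek by auto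
  have cancel: "of_real k * x = of_real k * y \<Longrightarrow> x = y" for x y :: complex using k0 by simp
  have "moebius (e * (a * \<gamma> + b * of_real \<alpha>)) (e * (a * - of_real \<beta> + b * - cnj \<gamma>))
      (e * (c * \<gamma> + d * of_real \<alpha>)) (e * (c * - of_real \<beta> + d * - cnj \<gamma>)) =
    moebius (\<gamma>' * cnj a + - of_real \<beta>' * cnj c) (\<gamma>' * cnj b + - of_real \<beta>' * cnj d)
      (of_real \<alpha>' * cnj a + - cnj \<gamma>' * cnj c) (of_real \<alpha>' * cnj b + - cnj \<gamma>' * cnj d)"
  proof -
    have 1: "e * (a * \<gamma> + b * of_real \<alpha>) = \<gamma>' * cnj a + - of_real \<beta>' * cnj c"
      by (rule cancel) (simp add: distrib_left right_diff_distrib mult.assoc[symmetric] a' b' g' g'' ek, simp add: algebra_simps)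
    have 2: "e * (a * - of_real \<beta> + b * - cnj \<gamma>) = \<gamma>' * cnj b + - of_real \<beta>' * cnj d"
      by (rule cancel) (simp add: distrib_left right_diff_distrib mult.assoc[symmetric] a' b' g' g'' ek, simp add: algebra_simps)
    have 3: "e * (c * \<gamma> + d * of_real \<alpha>) = of_real \<alpha>' * cnj a + - cnj \<gamma>' * cnj c"
      by (rule cancel) (simp add: distrib_left right_diff_distrib mult.assoc[symmetric] a' b' g' g'' ek, simp add: algebra_simps)
    have 4: "e * (c * - of_real \<beta> + d * - cnj \<gamma>) = of_real \<alpha>' * cnj b + - cnj \<gamma>' * cnj d"
      by (rule cancel) (simp add: distrib_left right_diff_distrib mult.assoc[symmetric] a' b' g' g'' ek, simp add: algebra_simps)
    show ?thesis unfolding 1 2 3 4 ..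
  qed
  then have m: "moebius a b c d \<circ> moebius \<gamma> (- of_real \<beta>) (of_real \<alpha>) (- cnj \<gamma>)
      = moebius \<gamma>' (- of_real \<beta>') (of_real \<alpha>') (- cnj \<gamma>') \<circ> moebius (cnj a) (cnj b) (cnj c) (cnj d)"
    unfolding moebius_comp[OF D d1] moebius_comp[OF d2 d3] moebius_scale[OF e0] .
  have i: "moebius a b c d \<circ> hinv \<alpha> \<beta> \<gamma> = hinv \<alpha>' \<beta>' \<gamma>' \<circ> moebius a b c d"
    unfolding hinv_def comp_assoc moebius_cnj
    using m by (simp add: comp_assoc[symmetric])
  have "moebius a b c d ` circ \<alpha> \<beta> \<gamma> = circ \<alpha>' \<beta>' \<gamma>'"
    unfolding circ_eq_fixpoints[OF s] circ_eq_fixpoints[OF s']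
    by (rule image_fixpoints[OF bij_moebius[OF D] i])
  with s' i show ?thesis by blast
qed

lemma bij_hinv:
  assumes "(norm \<gamma>)\<^sup>2 - \<alpha> * \<beta> = 1" shows "bij (hinv \<alpha> \<beta> \<gamma>)"
  using hinv_involution[OF assms] o_bij by blast

text \<open>On coordinates an inversion is the Lorentz reflection \<open>v - 2 <v, w> w\<close> for
  the form with \<open><v, v> = |\<gamma>|\<^sup>2 - \<alpha> \<beta>\<close>. Here
  \<open>k = 2 <v, w>\<close>, and \<open>k = 0\<close> means that the two circles are
  orthogonal.\<close>

lemma hinv_image_circ:
  assumes s: "(norm \<gamma>)\<^sup>2 - \<alpha> * \<beta> = 1" and t: "(norm \<epsilon>)\<^sup>2 - \<eta> * \<zeta> = 1"
  defines "k \<equiv> 2 * Re (\<gamma> * cnj \<epsilon>) - \<alpha> * \<zeta> - \<beta> * \<eta>"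
  shows "(norm (\<gamma> - of_real k * \<epsilon>))\<^sup>2 - (\<alpha> - k * \<eta>) * (\<beta> - k * \<zeta>) = 1"
    "hinv \<eta> \<zeta> \<epsilon> ` circ \<alpha> \<beta> \<gamma> = circ (\<alpha> - k * \<eta>) (\<beta> - k * \<zeta>) (\<gamma> - of_real k * \<epsilon>)"
proof -
  have g: "\<gamma> * cnj \<gamma> = of_real \<alpha> * of_real \<beta> + 1" "\<epsilon> * cnj \<epsilon> = of_real \<eta> * of_real \<zeta> + 1"
    using s t norm_sq_cnj by simp_all
  have k: "of_real k = \<gamma> * cnj \<epsilon> + cnj \<gamma> * \<epsilon> - of_real \<alpha> * of_real \<zeta> - of_real \<beta> * of_real \<eta>"
    using complex_add_cnj[of "\<gamma> * cnj \<epsilon>"] by (simp add: k_def)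
  have "(\<gamma> - of_real k * \<epsilon>) * cnj (\<gamma> - of_real k * \<epsilon>) - of_real (\<alpha> - k * \<eta>) * of_real (\<beta> - k * \<zeta>)
     = (\<gamma> * cnj \<gamma> - of_real \<alpha> * of_real \<beta>) + of_real k * of_real k * (\<epsilon> * cnj \<epsilon> - of_real \<eta> * of_real \<zeta>)
       - of_real k * (\<gamma> * cnj \<epsilon> + cnj \<gamma> * \<epsilon> - of_real \<alpha> * of_real \<zeta> - of_real \<beta> * of_real \<eta>)"
    by (simp add: algebra_simps)
  also have "\<dots> = 1" unfolding k[symmetric] using g by simp
  finally show s': "(norm (\<gamma> - of_real k * \<epsilon>))\<^sup>2 - (\<alpha> - k * \<eta>) * (\<beta> - k * \<zeta>) = 1"
    unfolding norm_sq_cnj by (simp add: algebra_simps)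
  let ?\<alpha> = "\<alpha> - k * \<eta>" and ?\<beta> = "\<beta> - k * \<zeta>" and ?\<gamma> = "\<gamma> - of_real k * \<epsilon>"
  \<comment> \<open>The two matrix products differ by the scalar \<open>- 1\<close>, which acts
    trivially.\<close>
  have m1: "(-1::complex) \<noteq> 0" by simp
  have 1: "-1 * (\<epsilon> * cnj \<gamma> - of_real \<zeta> * of_real \<alpha>) = ?\<gamma> * cnj \<epsilon> - of_real ?\<beta> * of_real \<eta>"
  proof -
    have "?\<gamma> * cnj \<epsilon> - of_real ?\<beta> * of_real \<eta> = \<gamma> * cnj \<epsilon> - of_real \<beta> * of_real \<eta>
      - of_real k * (\<epsilon> * cnj \<epsilon> - of_real \<eta> * of_real \<zeta>)" by (simp add: algebra_simps)
    also have "\<dots> = \<gamma> * cnj \<epsilon> - of_real \<beta> * of_real \<eta> - of_real k" using g by simp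
    finally show ?thesis by (simp add: k algebra_simps)
  qed
  have 2: "-1 * (of_real \<zeta> * \<gamma> - \<epsilon> * of_real \<beta>) = of_real ?\<beta> * \<epsilon> - ?\<gamma> * of_real \<zeta>"
    by (simp add: algebra_simps)
  have 3: "-1 * (of_real \<eta> * cnj \<gamma> - cnj \<epsilon> * of_real \<alpha>) = of_real ?\<alpha> * cnj \<epsilon> - cnj ?\<gamma> * of_real \<eta>"
    by (simp add: algebra_simps)
  have 4: "-1 * (cnj \<epsilon> * \<gamma> - of_real \<eta> * of_real \<beta>) = cnj ?\<gamma> * \<epsilon> - of_real ?\<alpha> * of_real \<zeta>"
  proof -
    have "cnj ?\<gamma> * \<epsilon> - of_real ?\<alpha> * of_real \<zeta> = cnj \<gamma> * \<epsilon> - of_real \<alpha> * of_real \<zeta>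
      - of_real k * (\<epsilon> * cnj \<epsilon> - of_real \<eta> * of_real \<zeta>)" by (simp add: algebra_simps)
    also have "\<dots> = cnj \<gamma> * \<epsilon> - of_real \<alpha> * of_real \<zeta> - of_real k" using g by simp
    finally show ?thesis by (simp add: k algebra_simps)
  qed
  have i: "hinv \<eta> \<zeta> \<epsilon> \<circ> hinv \<alpha> \<beta> \<gamma> = hinv ?\<alpha> ?\<beta> ?\<gamma> \<circ> hinv \<eta> \<zeta> \<epsilon>"
    unfolding hinv_comp_hinv[OF t s] hinv_comp_hinv[OF s' t]
    by (subst moebius_scale[OF m1, symmetric]) (simp only: 1 2 3 4)
  show "hinv \<eta> \<zeta> \<epsilon> ` circ \<alpha> \<beta> \<gamma> = circ ?\<alpha> ?\<beta> ?\<gamma>"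
    unfolding circ_eq_fixpoints[OF s] circ_eq_fixpoints[OF s']
    by (rule image_fixpoints[OF bij_hinv[OF t] i])
qed

section \<open>Circles, lines and inversions of the definitions in coordinates\<close>

text \<open>The scale is left free because the normalized coordinates of a circle are determined
  only up to sign.\<close>

lemma circle_inversion_eq_hinv:
  assumes "\<alpha> \<noteq> 0"
  shows "circle_inversion c r = hinv \<alpha> (\<alpha> * ((norm c)\<^sup>2 - r\<^sup>2)) (of_real \<alpha> * c)"
proof
  fix x
  show "circle_inversion c r x = hinv \<alpha> (\<alpha> * ((norm c)\<^sup>2 - r\<^sup>2)) (of_real \<alpha> * c) x"
  proof (cases x)
    case None
    then show ?thesis using assms by (simp add: circle_inversion_def hinv_def moebius_def)
  next
    case (Some z)
    have 1: "of_real \<alpha> * cnj z - of_real \<alpha> * cnj c = of_real \<alpha> * cnj (z - c)" by (simp add: algebra_simps)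
    have 2: "of_real \<alpha> * c * cnj z - of_real (\<alpha> * ((norm c)\<^sup>2 - r\<^sup>2)) = of_real \<alpha> * (c * cnj (z - c) + of_real (r\<^sup>2))"
      using complex_norm_square[of c] by (simp add: algebra_simps)
    show ?thesis
    proof (cases "z = c")
      case True
      then show ?thesis using Some by (simp add: circle_inversion_def hinv_def moebius_def)
    next
      case False
      have zc: "cnj z - cnj c \<noteq> 0" using False by (metis complex_cnj_diff complex_cnj_zero_iff right_minus_eq)
      then have "hinv \<alpha> (\<alpha> * ((norm c)\<^sup>2 - r\<^sup>2)) (of_real \<alpha> * c) x =
         Some (of_real \<alpha> * (c * cnj (z - c) + of_real (r\<^sup>2)) / (of_real \<alpha> * cnj (z - c)))"
        using Some assms 1 2 by (simp add: hinv_def moebius_def)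
      then show ?thesis using Some False assms zc
        by (simp add: circle_inversion_def add_divide_distrib)
    qed
  qed
qed

text \<open>Completing the square: \<open>|\<gamma> - \<alpha> z|\<^sup>2\<close> is 1 plus
  \<open>\<alpha>\<close> times the left side of the equation.\<close>

lemma circ_eq_ext_circle:
  assumes "\<alpha> \<noteq> 0" "(norm \<gamma>)\<^sup>2 - \<alpha> * \<beta> = 1"
  shows "circ \<alpha> \<beta> \<gamma> = ext_circle (\<gamma> / of_real \<alpha>) (1 / \<bar>\<alpha>\<bar>)"
proof -
  have g: "\<gamma> * cnj \<gamma> = of_real \<alpha> * of_real \<beta> + 1" using assms norm_sq_cnj by simp
  have "Some z \<in> circ \<alpha> \<beta> \<gamma> \<longleftrightarrow> norm (\<gamma> / of_real \<alpha> - z) = 1 / \<bar>\<alpha>\<bar>" for z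
  proof -
    have "norm (\<gamma> / of_real \<alpha> - z) = norm (\<gamma> - of_real \<alpha> * z) / \<bar>\<alpha>\<bar>"
    proof -
      have "\<gamma> / of_real \<alpha> - z = (\<gamma> - of_real \<alpha> * z) / of_real \<alpha>" using assms by (simp add: field_simps)
      then show ?thesis by (simp add: norm_divide)
    qed
    then have "norm (\<gamma> / of_real \<alpha> - z) = 1 / \<bar>\<alpha>\<bar> \<longleftrightarrow> norm (\<gamma> - of_real \<alpha> * z) = 1"
      using assms by simp
    also have "\<dots> \<longleftrightarrow> (norm (\<gamma> - of_real \<alpha> * z))\<^sup>2 = 1"
      by (smt (verit) norm_ge_zero power2_eq_1_iff)
    also have "\<dots> \<longleftrightarrow> (of_real ((norm (\<gamma> - of_real \<alpha> * z))\<^sup>2) :: complex) = 1"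
      by (metis of_real_eq_1_iff)
    also have "\<dots> \<longleftrightarrow> (\<gamma> - of_real \<alpha> * z) * cnj (\<gamma> - of_real \<alpha> * z) = 1"
      by (simp only: complex_norm_square)
    also have "(\<gamma> - of_real \<alpha> * z) * cnj (\<gamma> - of_real \<alpha> * z) =
       1 + of_real \<alpha> * (of_real \<alpha> * (z * cnj z) - cnj \<gamma> * z - \<gamma> * cnj z + of_real \<beta>)"
      using g by (simp add: algebra_simps)
    finally show ?thesis using assms by (simp add: circ_def)
  qed
  moreover have "None \<notin> circ \<alpha> \<beta> \<gamma>" using assms by (simp add: circ_def)
  ultimately have "x \<in> circ \<alpha> \<beta> \<gamma> \<longleftrightarrow> x \<in> ext_circle (\<gamma> / of_real \<alpha>) (1 / \<bar>\<alpha>\<bar>)" for x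
    unfolding ext_circle_def by (cases x) (simp_all add: image_iff dist_norm)
  then show ?thesis by blast
qed

text \<open>A circle determines its coordinates up to sign. The equation is evaluated at the four
  points \<open>c + r\<close>, \<open>c - r\<close>, \<open>c + \<i> r\<close>,
  \<open>c - \<i> r\<close>; differences of opposite points give \<open>\<gamma>\<close>, one point
  gives \<open>\<beta>\<close>, and the normalization gives the radius.\<close>

lemma ext_circle_eq_circD:
  assumes "ext_circle c r = circ \<alpha> \<beta> \<gamma>" "r > 0" "(norm \<gamma>)\<^sup>2 - \<alpha> * \<beta> = 1"
  shows "\<alpha> \<noteq> 0" "\<gamma> = of_real \<alpha> * c" "\<beta> = \<alpha> * ((norm c)\<^sup>2 - r\<^sup>2)" "r = 1 / \<bar>\<alpha>\<bar>"
proof -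
  have a0: "\<alpha> \<noteq> 0" using assms(1) by (auto simp: ext_circle_def circ_def)
  have mem: "Some (c + u) \<in> circ \<alpha> \<beta> \<gamma>" if "norm u = r" for u
    using that assms(1) by (auto simp: ext_circle_def dist_norm)
  define c1 c2 g1 g2 where "c1 = Re c" "c2 = Im c" "g1 = Re \<gamma>" "g2 = Im \<gamma>"
  note defs = this
  have eq: "\<alpha> * ((c1 + Re u)\<^sup>2 + (c2 + Im u)\<^sup>2) - 2 * (g1 * (c1 + Re u) + g2 * (c2 + Im u)) + \<beta> = 0"
    if "norm u = r" for u
    using mem[OF that] by (simp add: circ_def complex_eq_iff defs power2_eq_square algebra_simps)
  have e1: "\<alpha> * ((c1 + r)\<^sup>2 + c2\<^sup>2) - 2 * (g1 * (c1 + r) + g2 * c2) + \<beta> = 0"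
    using eq[of "of_real r"] assms(2) by simp
  have e2: "\<alpha> * ((c1 - r)\<^sup>2 + c2\<^sup>2) - 2 * (g1 * (c1 - r) + g2 * c2) + \<beta> = 0"
    using eq[of "of_real (- r)"] assms(2) by simp
  have e3: "\<alpha> * (c1\<^sup>2 + (c2 + r)\<^sup>2) - 2 * (g1 * c1 + g2 * (c2 + r)) + \<beta> = 0"
    using eq[of "\<i> * of_real r"] assms(2) by (simp add: norm_mult)
  have e4: "\<alpha> * (c1\<^sup>2 + (c2 - r)\<^sup>2) - 2 * (g1 * c1 + g2 * (c2 - r)) + \<beta> = 0"
    using eq[of "\<i> * of_real (- r)"] assms(2) by (simp add: norm_mult)
  have "4 * r * (\<alpha> * c1 - g1) = (\<alpha> * ((c1 + r)\<^sup>2 + c2\<^sup>2) - 2 * (g1 * (c1 + r) + g2 * c2) + \<beta>)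
      - (\<alpha> * ((c1 - r)\<^sup>2 + c2\<^sup>2) - 2 * (g1 * (c1 - r) + g2 * c2) + \<beta>)" by (simp add: power2_eq_square algebra_simps)
  then have "4 * r * (\<alpha> * c1 - g1) = 0" unfolding e1 e2 by simp
  then have g1: "g1 = \<alpha> * c1" using assms(2) by simp
  have "4 * r * (\<alpha> * c2 - g2) = (\<alpha> * (c1\<^sup>2 + (c2 + r)\<^sup>2) - 2 * (g1 * c1 + g2 * (c2 + r)) + \<beta>)
      - (\<alpha> * (c1\<^sup>2 + (c2 - r)\<^sup>2) - 2 * (g1 * c1 + g2 * (c2 - r)) + \<beta>)" by (simp add: power2_eq_square algebra_simps)
  then have "4 * r * (\<alpha> * c2 - g2) = 0" unfolding e3 e4 by simp
  then have g2: "g2 = \<alpha> * c2" using assms(2) by simp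
  show g: "\<gamma> = of_real \<alpha> * c" using g1 g2 by (simp add: complex_eq_iff defs)
  have n: "(norm c)\<^sup>2 = c1\<^sup>2 + c2\<^sup>2" by (simp add: cmod_power2 defs)
  show b: "\<beta> = \<alpha> * ((norm c)\<^sup>2 - r\<^sup>2)" using e1 unfolding g1 g2 n by (simp add: power2_eq_square algebra_simps)
  have "(\<alpha> * r)\<^sup>2 = 1" using assms(3) unfolding g b by (simp add: norm_mult power_mult_distrib power2_eq_square algebra_simps)
  then have "\<bar>\<alpha> * r\<bar> = 1" using power2_eq_1_iff[of "\<alpha> * r"] by (smt (verit))
  then show "r = 1 / \<bar>\<alpha>\<bar>" using assms(2) a0 by (simp add: abs_mult field_simps)
  show "\<alpha> \<noteq> 0" by (rule a0)
qed

lemma is_inversion_in_unique: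
  assumes "is_inversion_in (circ \<alpha> \<beta> \<gamma>) \<sigma>" "(norm \<gamma>)\<^sup>2 - \<alpha> * \<beta> = 1"
  shows "\<sigma> = hinv \<alpha> \<beta> \<gamma>"
  using assms(1) unfolding is_inversion_in_def
proof (elim disjE exE conjE)
  fix c r assume r: "r > 0" "circ \<alpha> \<beta> \<gamma> = ext_circle c r" and \<sigma>: "\<sigma> = circle_inversion c r"
  note c = ext_circle_eq_circD[OF r(2)[symmetric] r(1) assms(2)]
  show ?thesis unfolding \<sigma> c(2,3) by (rule circle_inversion_eq_hinv[OF c(1)])
next
  fix p u assume u: "u \<noteq> 0" and L: "circ \<alpha> \<beta> \<gamma> = ext_line p u" and \<sigma>: "\<sigma> = line_reflection p u"
  have a: "\<alpha> = 0"
  proof -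
    have "None \<in> circ \<alpha> \<beta> \<gamma>" unfolding L ext_line_def by simp
    then show ?thesis by (simp add: circ_def)
  qed
  then have g0: "\<gamma> \<noteq> 0" using assms(2) by auto
  have *: "Some (p + of_real t * u) \<in> circ \<alpha> \<beta> \<gamma>" for t
    unfolding L ext_line_def by auto
  have p: "of_real \<beta> = cnj \<gamma> * p + \<gamma> * cnj p" using *[of 0] a by (simp add: circ_def algebra_simps)
  have "of_real \<beta> = cnj \<gamma> * (p + u) + \<gamma> * cnj (p + u)" using *[of 1] a by (simp add: circ_def algebra_simps)
  then have "cnj \<gamma> * u = - \<gamma> * cnj u" using p by (simp add: algebra_simps add_eq_0_iff2)
  \<comment> \<open>The reflection involves the direction only through \<open>u / cnj u\<close>, and
    the points of the line with parameters 0 and 1 express this quotient by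
    \<open>\<gamma>\<close>.\<close>
  then have uu: "u / cnj u = - \<gamma> / cnj \<gamma>" using u g0 by (simp add: field_simps)
  show ?thesis
  proof
    fix x show "\<sigma> x = hinv \<alpha> \<beta> \<gamma> x"
      unfolding \<sigma> using g0 a p
      by (cases x) (auto simp: line_reflection_def hinv_def moebius_def uu field_simps)
  qed
qed

lemma is_inversion_in_circ:
  assumes "(norm \<gamma>)\<^sup>2 - \<alpha> * \<beta> = 1"
  shows "is_inversion_in (circ \<alpha> \<beta> \<gamma>) (hinv \<alpha> \<beta> \<gamma>)"
proof -
  have "\<exists>\<sigma>. is_inversion_in (circ \<alpha> \<beta> \<gamma>) \<sigma>"
  proof (cases "\<alpha> = 0")
    case False
    then have "1 / \<bar>\<alpha>\<bar> > 0" by simp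
    then show ?thesis unfolding is_inversion_in_def
      using circ_eq_ext_circle[OF False assms] by blast
  next
    case True
    then have gg: "\<gamma> * cnj \<gamma> = 1" using norm_sq_cnj[THEN iffD1, OF assms] by simp
    then have g0: "\<gamma> \<noteq> 0" by auto
    \<comment> \<open>For \<open>|\<gamma>| = 1\<close> the equation says that the real part of
      \<open>cnj \<gamma> * z\<close> is \<open>\<beta> / 2\<close>: the line is normal to
      \<open>\<gamma>\<close> at distance \<open>|\<beta>| / 2\<close> from the origin.\<close>
    have "circ \<alpha> \<beta> \<gamma> = ext_line (of_real (\<beta> / 2) * \<gamma>) (\<i> * \<gamma>)"
    proof -
      have "Some z \<in> circ \<alpha> \<beta> \<gamma> \<longleftrightarrow> (\<exists>t. z = of_real (\<beta> / 2) * \<gamma> + of_real t * (\<i> * \<gamma>))" for z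
      proof
        assume "Some z \<in> circ \<alpha> \<beta> \<gamma>"
        then have "cnj \<gamma> * z + \<gamma> * cnj z = of_real \<beta>" using True by (simp add: circ_def algebra_simps)
        then have "of_real (2 * Re (cnj \<gamma> * z)) = (of_real \<beta> :: complex)"
          using complex_add_cnj[of "cnj \<gamma> * z"] by simp
        then have "Re (cnj \<gamma> * z) = \<beta> / 2" by (metis of_real_eq_iff nonzero_mult_div_cancel_left zero_neq_numeral)
        then have "cnj \<gamma> * z = of_real (\<beta> / 2) + \<i> * of_real (Im (cnj \<gamma> * z))"
          by (simp add: complex_eq_iff)
        then have "\<gamma> * (cnj \<gamma> * z) = \<gamma> * (of_real (\<beta> / 2) + \<i> * of_real (Im (cnj \<gamma> * z)))" by simp
        moreover have "\<gamma> * (cnj \<gamma> * z) = z" using gg by (simp add: mult.assoc[symmetric])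
        ultimately have "z = of_real (\<beta> / 2) * \<gamma> + of_real (Im (cnj \<gamma> * z)) * (\<i> * \<gamma>)"
          by (simp only: algebra_simps)
        then show "\<exists>t. z = of_real (\<beta> / 2) * \<gamma> + of_real t * (\<i> * \<gamma>)" by blast
      next
        assume "\<exists>t. z = of_real (\<beta> / 2) * \<gamma> + of_real t * (\<i> * \<gamma>)"
        then obtain t where z: "z = of_real (\<beta> / 2) * \<gamma> + of_real t * (\<i> * \<gamma>)" by blast
        have "cnj \<gamma> * z + \<gamma> * cnj z = (\<gamma> * cnj \<gamma>) * of_real \<beta>" unfolding z by (simp add: algebra_simps)
        then show "Some z \<in> circ \<alpha> \<beta> \<gamma>" using gg True by (simp add: circ_def algebra_simps)
      qed
      moreover have "None \<in> circ \<alpha> \<beta> \<gamma>" using True by (simp add: circ_def)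
      ultimately have "x \<in> circ \<alpha> \<beta> \<gamma> \<longleftrightarrow> x \<in> ext_line (of_real (\<beta> / 2) * \<gamma>) (\<i> * \<gamma>)" for x
        unfolding ext_line_def by (cases x) (simp_all add: image_iff)
      then show ?thesis by blast
    qed
    moreover have "\<i> * \<gamma> \<noteq> 0" using g0 by simp
    ultimately show ?thesis unfolding is_inversion_in_def by blast
  qed
  then show ?thesis using is_inversion_in_unique[OF _ assms] by blast
qed

text \<open>The packing influences only the sign of the curvature, so the absolute value is the same
  for every \<open>P\<close>.\<close>

lemma abs_curvature_circ:
  assumes "(norm \<gamma>)\<^sup>2 - \<alpha> * \<beta> = 1"
  shows "\<bar>curvature P (circ \<alpha> \<beta> \<gamma>)\<bar> = \<bar>\<alpha>\<bar>"
proof (cases "\<alpha> = 0")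
  case True
  then have "\<not> (\<exists>c r. r > 0 \<and> circ \<alpha> \<beta> \<gamma> = ext_circle c r)"
    by (auto simp: circ_def ext_circle_def set_eq_iff)
  then show ?thesis using True unfolding curvature_def by (simp only: if_False)
next
  case False
  note c = circ_eq_ext_circle[OF False assms]
  have r: "1 / \<bar>\<alpha>\<bar> > 0" using False by simp
  have "(THE (c, r). r > 0 \<and> circ \<alpha> \<beta> \<gamma> = ext_circle c r) = (\<gamma> / of_real \<alpha>, 1 / \<bar>\<alpha>\<bar>)"
  proof (rule the_equality)
    show "case (\<gamma> / of_real \<alpha>, 1 / \<bar>\<alpha>\<bar>) of (c, r) \<Rightarrow> r > 0 \<and> circ \<alpha> \<beta> \<gamma> = ext_circle c r" using c r by simp
    fix x assume "case x of (c, r) \<Rightarrow> r > 0 \<and> circ \<alpha> \<beta> \<gamma> = ext_circle c r"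
    then obtain c r where x: "x = (c, r)" "r > 0" "ext_circle c r = circ \<alpha> \<beta> \<gamma>" by auto
    from ext_circle_eq_circD[OF x(3,2) assms] False
    show "x = (\<gamma> / of_real \<alpha>, 1 / \<bar>\<alpha>\<bar>)" by (simp add: x(1))
  qed
  moreover have "\<exists>c r. r > 0 \<and> circ \<alpha> \<beta> \<gamma> = ext_circle c r" using c r by blast
  ultimately show ?thesis unfolding curvature_def by (simp add: Let_def)
qed

text \<open>A negative sign requires the whole packing to lie in one closed disc, which a
  generalized circle through infinity prevents.\<close>

lemma curvature_nonneg:
  assumes "C' \<in> P" "None \<in> C'"
  shows "curvature P C \<ge> 0"
proof (cases "\<exists>c r. r > 0 \<and> C = ext_circle c r")
  case False then show ?thesis unfolding curvature_def by (simp only: if_False order_refl)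
next
  case True
  then obtain c r where r: "r > 0" "C = ext_circle c r" by blast
  have "(THE (c, r). r > 0 \<and> C = ext_circle c r) = (c, r)"
  proof (rule the_equality)
    show "case (c, r) of (c, r) \<Rightarrow> r > 0 \<and> C = ext_circle c r" using r by simp
    fix x assume "case x of (c, r) \<Rightarrow> r > 0 \<and> C = ext_circle c r"
    then obtain c' r' where x: "x = (c', r')" "r' > 0" "ext_circle c' r' = ext_circle c r" using r by auto
    \<comment> \<open>Normalized coordinates of the circle, so that the uniqueness of centre and
      radius follows from the uniqueness of coordinates.\<close>
    let ?b = "1 / r * ((norm c)\<^sup>2 - r\<^sup>2)" and ?g = "of_real (1 / r) * c"
    have n: "(norm ?g)\<^sup>2 - 1 / r * ?b = 1" using r(1)
      by (simp add: norm_mult norm_divide power_mult_distrib power_divide field_simps power2_eq_square)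
    have "ext_circle c r = circ (1 / r) ?b ?g"
      using circ_eq_ext_circle[OF _ n] r(1) by simp
    then show "x = (c, r)" using ext_circle_eq_circD(2,4)[OF _ x(2) n, of c'] x r(1) by simp
  qed
  moreover have "\<not> C' \<subseteq> Some ` cball c r" using assms(2) by auto
  ultimately show ?thesis using True assms(1) r(1) unfolding curvature_def by auto
qed

section \<open>The Kronecker symbol and values of binary forms\<close>

lemma Legendre_square:
  assumes "\<not> p dvd m" shows "Legendre m p ^ 2 = 1"
  using assms by (auto simp: Legendre_def cong_0_iff)

text \<open>Every prime factor occurs to an even power and its local symbol is 1 or
  \<open>- 1\<close> by coprimality; the sign factor is 1 because a square is not negative.\<close>

lemma kronecker_square:
  assumes n: "n \<noteq> 0" and cop: "coprime m n"
  shows "kronecker m (n\<^sup>2) = 1"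
proof -
  have "kronecker_prime m p ^ multiplicity p (n\<^sup>2) = 1" if p: "p \<in> prime_factors (n\<^sup>2)" for p
  proof -
    have pp: "prime p" "p dvd n" using p by (auto intro: prime_dvd_power simp: in_prime_factors_iff)
    then have nd: "\<not> p dvd m" using cop by (meson coprime_common_divisor not_prime_unit)
    have "(kronecker_prime m p)\<^sup>2 = 1"
      using nd Legendre_square[OF nd] by (auto simp: kronecker_prime_def)
    moreover have "multiplicity p (n\<^sup>2) = 2 * multiplicity p n"
      using prime_elem_multiplicity_power_distrib[OF prime_imp_prime_elem[OF pp(1)] n] by simp
    ultimately show ?thesis by (simp add: power_mult)
  qed
  then show ?thesis using n by (simp add: kronecker_def not_less)
qed

text \<open>Puts squares into the case of \<open>chi\<close> in which no sign is added to the
  Kronecker symbol.\<close>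

lemma square_mod_8: "(n::int)\<^sup>2 mod 8 \<in> {0, 1, 4}"
proof -
  have "n mod 8 \<in> {0..<8}" by simp
  then have "n mod 8 \<in> {0,1,2,3,4,5,6,7}" by fastforce
  moreover have "n\<^sup>2 mod 8 = (n mod 8)\<^sup>2 mod 8" by (simp add: power_mod)
  ultimately show ?thesis by auto
qed

lemma chi_square:
  assumes "n \<noteq> 0" "coprime (n\<^sup>2) b"
  shows "chi (n\<^sup>2) b = 1"
proof -
  have "coprime n (n\<^sup>2 + b)"
  proof (rule coprimeI)
    fix d assume d: "d dvd n" "d dvd n\<^sup>2 + b"
    then have n2: "d dvd n\<^sup>2" by (simp add: power2_eq_square)
    then have "d dvd b" using d(2) dvd_add_right_iff by blast
    then show "is_unit d" using assms(2) n2 coprime_common_divisor by blast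
  qed
  then have "kronecker (n\<^sup>2 + b) (n\<^sup>2) = 1" using kronecker_square[OF assms(1)] by (simp add: coprime_commute)
  then show ?thesis using square_mod_8[of n] by (auto simp: chi_def Let_def)
qed

section \<open>Values of binary quadratic forms coprime to a given integer\<close>

lemma common_prime_divisor:
  fixes a b :: int
  assumes "\<not> coprime a b" "b \<noteq> 0"
  obtains p where "prime p" "p dvd a" "p dvd b"
proof -
  have "\<not> is_unit (gcd a b)" "gcd a b \<noteq> 0" using assms by (auto simp: is_unit_gcd)
  then obtain p where "prime p" "p dvd gcd a b" using prime_divisor_exists by blast
  then show thesis using that by simp
qed

lemma prime_dvd_prod_primes:
  fixes p :: int
  assumes "prime p" "finite A" "\<And>q. q \<in> A \<Longrightarrow> prime q"
  shows "p dvd \<Prod>A \<longleftrightarrow> p \<in> A"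
  using assms by (metis dvd_refl prime_dvd_prod_iff primes_dvd_imp_eq)

text \<open>
  Take \<open>y\<close> to be the product of the primes dividing both \<open>a\<close> and \<open>R\<close>, and \<open>x\<close> twice the product of
  the other prime factors of \<open>a\<close>; modulo each prime factor of \<open>a\<close>, only one square term of the form
  survives.
\<close>

lemma form_value_coprime_nonzero:
  fixes a P C R :: int
  assumes a: "a \<noteq> 0" and even: "even a \<Longrightarrow> odd R"
    and prim: "\<And>p. prime p \<Longrightarrow> odd p \<Longrightarrow> p dvd a \<Longrightarrow> p dvd P \<Longrightarrow> \<not> p dvd R"
  shows "\<exists>x y. coprime x y \<and> odd (x + y) \<and> coprime (P * x\<^sup>2 + 2 * C * x * y + R * y\<^sup>2) a"
proof -
  define X Y where "X = {p \<in> prime_factors a. \<not> p dvd R}" and "Y = {p \<in> prime_factors a. p dvd R}"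
  have fin: "finite X" "finite Y" by (simp_all add: X_def Y_def)
  have pr: "\<And>q. q \<in> X \<Longrightarrow> prime q" "\<And>q. q \<in> Y \<Longrightarrow> prime q" by (auto simp: X_def Y_def)
  define x y where "x = 2 * \<Prod>X" and "y = \<Prod>Y"
  have x: "p dvd x \<longleftrightarrow> p = 2 \<or> (p dvd a \<and> \<not> p dvd R)" if "prime p" for p
    using that a prime_dvd_prod_primes[OF that fin(1) pr(1)] primes_dvd_imp_eq[of p 2]
    by (auto simp: x_def prime_dvd_mult_iff X_def prime_factors_dvd)
  have y: "p dvd y \<longleftrightarrow> p dvd a \<and> p dvd R" if "prime p" for p
    using that a prime_dvd_prod_primes[OF that fin(2) pr(2)]
    by (auto simp: y_def Y_def prime_factors_dvd)
  \<comment> \<open>The prime 2 is not in \<open>Y\<close>: if it divides \<open>a\<close>, then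
    \<open>R\<close> is odd. So \<open>x\<close> is even and \<open>y\<close> is odd, which gives
    the parity of \<open>x + y\<close>.\<close>
  have ey: "odd y" using y[of 2] even by auto
  have ex: "even x" by (simp add: x_def)
  have c1: "coprime x y"
  proof (rule ccontr)
    assume "\<not> coprime x y"
    then obtain p where p: "prime p" "p dvd x" "p dvd y"
      using common_prime_divisor[of x y] ey by (metis dvd_0_right)
    then show False using x[OF p(1)] y[OF p(1)] ey by auto
  qed
  have c2: "coprime (P * x\<^sup>2 + 2 * C * x * y + R * y\<^sup>2) a"
  proof (rule ccontr)
    assume "\<not> coprime (P * x\<^sup>2 + 2 * C * x * y + R * y\<^sup>2) a"
    then obtain p where p: "prime p" "p dvd P * x\<^sup>2 + 2 * C * x * y + R * y\<^sup>2" "p dvd a"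
      using common_prime_divisor a by blast
    show False
    proof (cases "p dvd x")
      case True
      then have "p dvd P * x\<^sup>2 + 2 * C * x * y" by (simp add: power2_eq_square)
      then have "p dvd R * y\<^sup>2" using p(2) by (metis dvd_add_right_iff)
      then have "p dvd R \<or> p dvd y" using p(1) by (meson prime_dvd_mult_iff prime_dvd_power)
      moreover have "p = 2 \<Longrightarrow> odd R" using even p(3) by simp
      ultimately show False using True x[OF p(1)] y[OF p(1)] ey by auto
    next
      case False
      then have "p \<noteq> 2" using ex by blast
      then have odd: "odd p" using primes_dvd_imp_eq[of 2 p] p(1) by auto
      have R: "p dvd R" using False x[OF p(1)] p(3) by blast
      then have "p dvd y" using y[OF p(1)] p(3) by blast
      then have "p dvd 2 * C * x * y + R * y\<^sup>2" by (simp add: power2_eq_square)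
      then have "p dvd P * x\<^sup>2" using p(2) by (metis add.assoc dvd_add_left_iff)
      then have "p dvd P" using p(1) False by (meson prime_dvd_mult_iff prime_dvd_power)
      then show False using prim[OF p(1) odd p(3)] R by blast
    qed
  qed
  show ?thesis using c1 c2 ex ey by (intro exI[of _ x] exI[of _ y]) auto
qed

text \<open>A form of discriminant zero with coprime outer coefficients is plus or minus the square
  of a linear form \<open>u x + w y\<close> with coprime \<open>u\<close>, \<open>w\<close>. A
  Bezout pair makes this 1, and since \<open>u\<close> and \<open>w\<close> are odd,
  \<open>x + y\<close> is odd as well.\<close>

lemma form_value_coprime_zero:
  fixes P C R :: int
  assumes disc: "P * R = C\<^sup>2" and odd: "odd P" "odd R" and cop: "coprime P R"
  shows "\<exists>x y. coprime x y \<and> odd (x + y) \<and> \<bar>P * x\<^sup>2 + 2 * C * x * y + R * y\<^sup>2\<bar> = 1"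
proof -
  define u where "u = gcd P C"
  have P0: "P \<noteq> 0" using odd by auto
  then obtain k v where k: "P = u * k" and v: "C = u * v" and kv: "coprime k v" and u0: "u \<noteq> 0"
    using gcd_coprime_exists[of P C] unfolding u_def by (metis gcd_eq_0_iff mult.commute)
  have kR: "k * R = u * v\<^sup>2" using disc u0 unfolding k v by (simp add: power2_eq_square algebra_simps)
  \<comment> \<open>Coprimality of \<open>P\<close> and \<open>R\<close> gives
    \<open>u dvd k\<close>, and coprimality of \<open>k\<close> and \<open>v\<close> gives
    \<open>k dvd u\<close>; hence \<open>P\<close> is plus or minus
    \<open>u\<^sup>2\<close>.\<close>
  have "coprime u R" using cop k by simp
  then have "u dvd k" using kR by (metis coprime_dvd_mult_left_iff dvd_triv_left)
  moreover have "k dvd u" using kR kv by (metis coprime_dvd_mult_left_iff coprime_power_right_iff dvd_triv_left)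
  ultimately have "k = u \<or> k = - u" by (metis dvd_antisym abs_eq_iff zdvd_antisym_abs)
  then obtain e where e: "k = e * u" "e = 1 \<or> e = -1" by (metis mult_1 mult_minus1)
  define w where "w = e * v"
  have ee: "e * e = 1" using e(2) by auto
  have v': "v = e * w" using ee by (simp add: w_def mult.assoc[symmetric])
  have R: "R = e * w\<^sup>2" using kR u0 e(2) unfolding e(1) v' by (auto simp: power2_eq_square)
  have "coprime u w" using kv e unfolding w_def by auto
  then obtain x y where xy: "u * x + w * y = 1" using bezout_int[of u w] by (metis coprime_imp_gcd_eq_1 mult.commute)
  have "coprime x y" by (rule coprimeI) (metis xy dvd_add dvd_mult)
  moreover have "odd (x + y)"
  proof -
    have "odd (u * x + w * y)" unfolding xy by simp
    moreover have "odd u" "odd w" using odd k R by auto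
    ultimately show ?thesis by simp
  qed
  moreover have "P * x\<^sup>2 + 2 * C * x * y + R * y\<^sup>2 = e * (u * x + w * y)\<^sup>2"
    unfolding k v v' R e(1) by (simp add: power2_eq_square algebra_simps)
  ultimately show ?thesis using xy e(2) by (intro exI[of _ x] exI[of _ y]) auto
qed

text \<open>Being coprime to 0 means being a unit, so \<open>a = 0\<close> needs the value 1 or
  \<open>- 1\<close>; there the form degenerates to discriminant zero.\<close>

lemma form_value_coprime:
  fixes a P C R :: int
  assumes disc: "P * R = C\<^sup>2 + 4 * a\<^sup>2" and even: "even a \<Longrightarrow> odd P \<and> odd R"
    and prim: "\<And>p. prime p \<Longrightarrow> odd p \<Longrightarrow> p dvd a \<Longrightarrow> p dvd P \<Longrightarrow> \<not> p dvd R"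
  shows "\<exists>x y. coprime x y \<and> odd (x + y) \<and> coprime (P * x\<^sup>2 + 2 * C * x * y + R * y\<^sup>2) a"
proof (cases "a = 0")
  case False
  then show ?thesis using form_value_coprime_nonzero[of a R P C] even prim by blast
next
  case True
  then have odd: "odd P" "odd R" using even by auto
  have "coprime P R"
  proof (rule ccontr)
    assume "\<not> coprime P R"
    then obtain p where p: "prime p" "p dvd P" "p dvd R"
      using common_prime_divisor[of P R] odd(2) by (metis dvd_0_right)
    moreover have "odd p" using p(2) odd(1) dvd_trans by blast
    ultimately show False using prim[of p] True by simp
  qed
  moreover have "P * R = C\<^sup>2" using disc True by simp
  ultimately obtain x y where "coprime x y" "odd (x + y)" "\<bar>P * x\<^sup>2 + 2 * C * x * y + R * y\<^sup>2\<bar> = 1"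
    using form_value_coprime_zero[of P R C] odd by blast
  then show ?thesis using True by (intro exI[of _ x] exI[of _ y]) simp
qed

text \<open>The \<open>Pi\<close> stand for the curvature \<open>a\<close> plus those of the four
  neighbours, with opposite neighbours paired. Odd primes obstruct neither form, because a common
  divisor of \<open>a\<close> and one pair divides the other pair too. For even \<open>a\<close>,
  the two members of each pair have equal parity and not all four are even, so one pair is odd and
  its form is chosen.\<close>

lemma quadruple_form_value_coprime:
  fixes a P1 P2 P3 P4 :: int
  assumes sum: "P1 + P2 = P3 + P4" and disc: "4 * P1 * P2 - (P3 - P4)\<^sup>2 = 16 * a\<^sup>2"
    and prim: "\<And>p. prime p \<Longrightarrow> p dvd a \<Longrightarrow> p dvd P1 \<Longrightarrow> p dvd P2 \<Longrightarrow> p dvd P3 \<Longrightarrow> p dvd P4 \<Longrightarrow> False"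
  shows "\<exists>P R C x y. (P, R, 2 * C) \<in> {(P1, P2, P3 - P4), (P3, P4, P1 - P2)} \<and>
    coprime x y \<and> odd (x + y) \<and> coprime (P * x\<^sup>2 + 2 * C * x * y + R * y\<^sup>2) a"
proof -
  have disc': "4 * P3 * P4 - (P1 - P2)\<^sup>2 = 16 * a\<^sup>2"
  proof -
    have "4 * P3 * P4 - (P1 - P2)\<^sup>2 = (P3 + P4)\<^sup>2 - (P3 - P4)\<^sup>2 - (P1 - P2)\<^sup>2"
      by (simp add: power2_eq_square algebra_simps)
    also have "\<dots> = 4 * P1 * P2 - (P3 - P4)\<^sup>2"
      unfolding sum[symmetric] by (simp add: power2_eq_square algebra_simps)
    finally show ?thesis using disc by simp
  qed
  have half: "even (R1 - R2)" if "4 * Q1 * Q2 - (R1 - R2)\<^sup>2 = 16 * a\<^sup>2" for Q1 Q2 R1 R2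
  proof -
    have "(R1 - R2)\<^sup>2 = 4 * (Q1 * Q2 - 4 * a\<^sup>2)" using that by (simp add: algebra_simps)
    then have "even ((R1 - R2)\<^sup>2)" by simp
    then show ?thesis by simp
  qed
  \<comment> \<open>The discriminant shows that \<open>p\<close> divides \<open>R1 - R2\<close>, and
    the sum relation that it divides \<open>R1 + R2\<close>; being odd, it divides \<open>R1\<close>
    and \<open>R2\<close>.\<close>
  have prim': False
    if "prime p" "odd p" "p dvd a" "p dvd Q1" "p dvd Q2" "Q1 + Q2 = R1 + R2"
      "4 * Q1 * Q2 - (R1 - R2)\<^sup>2 = 16 * a\<^sup>2" "{Q1, Q2, R1, R2} = {P1, P2, P3, P4}" for p Q1 Q2 R1 R2
  proof -
    have "(R1 - R2)\<^sup>2 = 4 * Q1 * Q2 - 16 * a\<^sup>2" using that by simp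
    also have "p dvd \<dots>" using that by (intro dvd_diff) (simp_all add: power2_eq_square)
    finally have d: "p dvd R1 - R2" using that prime_dvd_power by blast
    have s: "p dvd R1 + R2" using that by (metis dvd_add)
    have "p \<noteq> 2" using that by auto
    then have "\<not> p dvd 2" using primes_dvd_imp_eq[of p 2] that by auto
    moreover have "p dvd 2 * R1" "p dvd 2 * R2" using dvd_add[OF d s] dvd_diff[OF s d] by simp_all
    ultimately have "p dvd R1" "p dvd R2" using that(1) by (simp_all add: prime_dvd_mult_iff)
    then have "\<forall>v\<in>{P1, P2, P3, P4}. p dvd v" using that(4,5) unfolding that(8)[symmetric] by simp
    then show False using prim[OF that(1,3)] by simp
  qed
  have result: ?thesis
    if h1: "(Q1, Q2, R1 - R2) \<in> {(P1, P2, P3 - P4), (P3, P4, P1 - P2)}" and h2: "even a \<Longrightarrow> odd Q1 \<and> odd Q2"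
      and h3: "Q1 + Q2 = R1 + R2" and h4: "4 * Q1 * Q2 - (R1 - R2)\<^sup>2 = 16 * a\<^sup>2" and h5: "{Q1, Q2, R1, R2} = {P1, P2, P3, P4}" for Q1 Q2 R1 R2
  proof -
    obtain C where C: "R1 - R2 = 2 * C" using half[OF h4] by blast
    have "Q1 * Q2 = C\<^sup>2 + 4 * a\<^sup>2" using h4 unfolding C by (simp add: power2_eq_square)
    then obtain x y where "coprime x y" "odd (x + y)" "coprime (Q1 * x\<^sup>2 + 2 * C * x * y + Q2 * y\<^sup>2) a"
      using form_value_coprime[of Q1 Q2 C a] h2 prim'[OF _ _ _ _ _ h3 h4 h5] by blast
    then show ?thesis using h1 C by (metis (no_types))
  qed
  show ?thesis
  proof (cases "even a \<longrightarrow> odd P1 \<and> odd P2")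
    case True
    then show ?thesis using result[of P1 P2 P3 P4] sum disc by auto
  next
    case False
    have e: "even (P1 - P2)" "even (P3 - P4)" using half[OF disc] half[OF disc'] by blast+
    then have "odd P3 \<and> odd P4" using False prim[of 2] by auto
    then show ?thesis using result[of P3 P4 P1 P2] sum disc' by (auto simp: insert_commute)
  qed
qed

text \<open>
  Euclid's algorithm with even quotients reduces \<open>(x, y)\<close> to \<open>(\<plusminus>1, 0)\<close> or \<open>(0, \<plusminus>1)\<close>; it preserves the
  parity of \<open>x + y\<close>, which is why the two entries are never equal in absolute value.
\<close>

lemma binary_form_descent:
  fixes Q :: "int \<Rightarrow> int \<Rightarrow> int \<Rightarrow> bool"
  assumes val: "\<And>P C R. Q P C R \<Longrightarrow> N P"
    and neg: "\<And>P C R. Q P C R \<Longrightarrow> Q P (- C) R"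
    and swap: "\<And>P C R. Q P C R \<Longrightarrow> Q R C P"
    and refl: "\<And>P C R. Q P C R \<Longrightarrow> Q P (- 2 * P - C) (4 * P + 4 * C + R)"
    and "Q P C R" "coprime x y" "odd (x + y)"
  shows "N (P * x\<^sup>2 + 2 * C * x * y + R * y\<^sup>2)"
  using assms(5-)
proof (induction "nat (\<bar>x\<bar> + \<bar>y\<bar>)" arbitrary: P C R x y rule: less_induct)
  case less
  \<comment> \<open>The case in which \<open>x\<close> and \<open>y\<close> do not have opposite
    signs and \<open>x\<close> dominates. The pair \<open>x0\<close>, \<open>y0\<close> is the
    original one, so that the induction hypothesis also serves after sign changes and a swap, which
    keep the size.\<close>
  have main: "N (P * x\<^sup>2 + 2 * C * x * y + R * y\<^sup>2)"
    if q: "Q P C R" and c: "coprime x y" and o: "odd (x + y)" and lt: "\<bar>y\<bar> < \<bar>x\<bar>" and nn: "0 \<le> x * y"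
      and m: "\<bar>x\<bar> + \<bar>y\<bar> = \<bar>x0\<bar> + \<bar>y0\<bar>" and ih: "\<And>x y P C R.
       nat (\<bar>x\<bar> + \<bar>y\<bar>) < nat (\<bar>x0\<bar> + \<bar>y0\<bar>) \<Longrightarrow> Q P C R \<Longrightarrow> coprime x y \<Longrightarrow> odd (x + y) \<Longrightarrow>
       N (P * x\<^sup>2 + 2 * C * x * y + R * y\<^sup>2)"
    for P C R x y x0 y0
  proof (cases "y = 0")
    case True
    then have "\<bar>x\<bar> = 1" using c by simp
    then have "x\<^sup>2 = 1" by (metis one_power2 power2_abs)
    then show ?thesis using val[OF q] True by simp
  next
    case False
    have lt': "\<bar>x - 2 * y\<bar> < \<bar>x\<bar>" using lt nn False by (auto simp: zero_le_mult_iff)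
    have c': "coprime (x - 2 * y) (- y)"
    proof -
      have "coprime (x - 2 * y) y"
      proof (rule coprimeI)
        fix d assume d: "d dvd x - 2 * y" "d dvd y"
        then have "d dvd (x - 2 * y) + 2 * y" by (intro dvd_add) auto
        then show "is_unit d" using d(2) c coprime_common_divisor[of x y d] by simp
      qed
      then show ?thesis by simp
    qed
    \<comment> \<open>The form given by \<open>refl\<close>, evaluated at
      \<open>(x - 2 y, - y)\<close>, has the value of the original form at
      \<open>(x, y)\<close>.\<close>
    have "N (P * (x - 2 * y)\<^sup>2 + 2 * (- 2 * P - C) * (x - 2 * y) * (- y) + (4 * P + 4 * C + R) * (- y)\<^sup>2)"
    proof (rule ih[OF _ refl[OF q] c'])
      show "nat (\<bar>x - 2 * y\<bar> + \<bar>- y\<bar>) < nat (\<bar>x0\<bar> + \<bar>y0\<bar>)" using lt' m by linarith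
      show "odd (x - 2 * y + - y)" using o by simp
    qed
    then show ?thesis by (simp add: power2_eq_square algebra_simps)
  qed
  have ih: "\<And>x' y' P C R. nat (\<bar>x'\<bar> + \<bar>y'\<bar>) < nat (\<bar>x\<bar> + \<bar>y\<bar>) \<Longrightarrow> Q P C R \<Longrightarrow> coprime x' y' \<Longrightarrow> odd (x' + y') \<Longrightarrow>
       N (P * x'\<^sup>2 + 2 * C * x' * y' + R * y'\<^sup>2)"
    using less.hyps by blast
  have ne: "\<bar>x\<bar> \<noteq> \<bar>y\<bar>" using less.prems(3) by (auto simp: abs_eq_iff)
  \<comment> \<open>A sign change of the middle coefficient and a swap of the outer ones bring all
    four cases to \<open>main\<close>.\<close>
  consider "\<bar>y\<bar> < \<bar>x\<bar>" "0 \<le> x * y" | "\<bar>y\<bar> < \<bar>x\<bar>" "0 \<le> x * (- y)"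
    | "\<bar>x\<bar> < \<bar>y\<bar>" "0 \<le> y * x" | "\<bar>x\<bar> < \<bar>y\<bar>" "0 \<le> y * (- x)"
  proof -
    have "0 \<le> x * y \<or> 0 \<le> x * (- y)" by auto
    moreover have "\<bar>y\<bar> < \<bar>x\<bar> \<or> \<bar>x\<bar> < \<bar>y\<bar>" using ne by linarith
    ultimately show thesis using that by (auto simp: mult.commute)
  qed
  then show ?case
  proof cases
    case 1
    then show ?thesis using main[OF less.prems 1 HOL.refl ih] by simp
  next
    case 2
    have "N (P * x\<^sup>2 + 2 * (- C) * x * (- y) + R * (- y)\<^sup>2)"
      by (rule main[OF neg[OF less.prems(1)] _ _ _ 2(2) _ ih]) (use less.prems 2 in auto)
    then show ?thesis by simp
  next
    case 3
    have "N (R * y\<^sup>2 + 2 * C * y * x + P * x\<^sup>2)"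
      by (rule main[OF swap[OF less.prems(1)] _ _ _ 3(2) _ ih]) (use less.prems 3 in \<open>auto simp: coprime_commute add.commute\<close>)
    then show ?thesis by (simp add: algebra_simps)
  next
    case 4
    have "N (R * y\<^sup>2 + 2 * (- C) * y * (- x) + P * (- x)\<^sup>2)"
      by (rule main[OF neg[OF swap[OF less.prems(1)]] _ _ _ 4(2) _ ih]) (use less.prems 4 in \<open>auto simp: coprime_commute add.commute\<close>)
    then show ?thesis by (simp add: algebra_simps)
  qed
qed

section \<open>Curvatures in a square packing\<close>

text \<open>
  A functional reads off the oriented curvature of the image of a circle from the coordinates of the
  circle. It is isotropic because it is the Lorentz pairing with a null vector, namely the preimage of
  the point at infinity.
\<close>

type_synonym functional = "real \<times> real \<times> real \<times> real"

fun apply_circ :: "functional \<Rightarrow> real \<Rightarrow> real \<Rightarrow> complex \<Rightarrow> real" where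
  "apply_circ (p, q, s, t) \<alpha> \<beta> \<gamma> = p * \<alpha> + q * \<beta> + s * Re \<gamma> + t * Im \<gamma>"

text \<open>The arguments are the normalized coordinates of the unit circle centred at
  \<open>(X, Y)\<close>. Two even entries give circles of the configuration, two odd entries give
  dual circles.\<close>

definition grid_value :: "functional \<Rightarrow> int \<Rightarrow> int \<Rightarrow> real" where
  "grid_value \<phi> X Y = apply_circ \<phi> 1 ((of_int X)\<^sup>2 + (of_int Y)\<^sup>2 - 1) (Complex (of_int X) (of_int Y))"

text \<open>The functional precomposed with the Lorentz reflection that the inversion in the unit
  circle at \<open>(X, Y)\<close> induces on coordinates.\<close>

fun reflect :: "int \<Rightarrow> int \<Rightarrow> functional \<Rightarrow> functional" where
  "reflect X Y (p, q, s, t) = (let k = grid_value (p, q, s, t) X Y in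
     (p + k * ((of_int X)\<^sup>2 + (of_int Y)\<^sup>2 - 1), q + k, s - 2 * k * of_int X, t - 2 * k * of_int Y))"

fun isotropic :: "functional \<Rightarrow> bool" where
  "isotropic (p, q, s, t) \<longleftrightarrow> s\<^sup>2 + t\<^sup>2 = 4 * p * q"

abbreviation grid_circle :: "int \<Rightarrow> int \<Rightarrow> ext_plane set" where
  "grid_circle X Y \<equiv> ext_circle (Complex (of_int X) (of_int Y)) 1"

abbreviation grid_inversion :: "int \<Rightarrow> int \<Rightarrow> ext_plane \<Rightarrow> ext_plane" where
  "grid_inversion X Y \<equiv> circle_inversion (Complex (of_int X) (of_int Y)) 1"

text \<open>The factor is minus twice the Lorentz product of the two unit circles. It vanishes when
  the squared distance of the centres is 2, that is, when the circles are orthogonal.\<close>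

lemma grid_value_reflect:
  "grid_value (reflect X Y \<phi>) U V =
    grid_value \<phi> U V + ((of_int (U - X))\<^sup>2 + (of_int (V - Y))\<^sup>2 - 2) * grid_value \<phi> X Y"
  by (cases \<phi>) (simp add: grid_value_def Let_def power2_eq_square algebra_simps)

lemma reflect_reflect: "reflect X Y (reflect X Y \<phi>) = \<phi>"
proof -
  obtain p q s t where \<phi>: "\<phi> = (p, q, s, t)" by (cases \<phi>)
  have "grid_value (reflect X Y \<phi>) X Y = - grid_value \<phi> X Y" by (simp add: grid_value_reflect)
  then show ?thesis unfolding \<phi> by (simp add: Let_def)
qed

lemma isotropic_reflect:
  assumes "isotropic \<phi>" shows "isotropic (reflect X Y \<phi>)"
proof -
  obtain p q s t where \<phi>: "\<phi> = (p, q, s, t)" by (cases \<phi>)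
  define k x y where "k = grid_value \<phi> X Y" and "x = real_of_int X" and "y = real_of_int Y"
  have k: "k = p + q * (x\<^sup>2 + y\<^sup>2 - 1) + s * x + t * y"
    by (simp add: k_def x_def y_def \<phi> grid_value_def)
  have "(s - 2 * k * x)\<^sup>2 + (t - 2 * k * y)\<^sup>2 - 4 * (p + k * (x\<^sup>2 + y\<^sup>2 - 1)) * (q + k)
    = (s\<^sup>2 + t\<^sup>2 - 4 * p * q) - 4 * k * (p + q * (x\<^sup>2 + y\<^sup>2 - 1) + s * x + t * y) + 4 * k\<^sup>2"
    by (simp add: power2_eq_square algebra_simps)
  also have "\<dots> = 0" unfolding k[symmetric] using assms \<phi> by (simp add: power2_eq_square)
  finally show ?thesis unfolding \<phi>
    by (simp add: Let_def k_def[symmetric, unfolded \<phi>] x_def[symmetric] y_def[symmetric])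
qed

text \<open>Only the first coordinate of the image is prescribed; the others are existential because
  they do not enter the curvature.\<close>

definition represents :: "(ext_plane \<Rightarrow> ext_plane) \<Rightarrow> functional \<Rightarrow> bool" where
  "represents \<nu> \<phi> \<longleftrightarrow> (\<forall>\<alpha> \<beta> \<gamma>. (norm \<gamma>)\<^sup>2 - \<alpha> * \<beta> = 1 \<longrightarrow>
     (\<exists>\<beta>' \<gamma>'. (norm \<gamma>')\<^sup>2 - apply_circ \<phi> \<alpha> \<beta> \<gamma> * \<beta>' = 1 \<and>
       \<nu> ` circ \<alpha> \<beta> \<gamma> = circ (apply_circ \<phi> \<alpha> \<beta> \<gamma>) \<beta>' \<gamma>'))"

lemma grid_normalized:
  "(norm (Complex (of_int X) (of_int Y)))\<^sup>2 - 1 * ((of_int X)\<^sup>2 + (of_int Y)\<^sup>2 - 1) = 1"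
  by (simp add: cmod_power2)

lemma grid_circle_eq_circ:
  "grid_circle X Y = circ 1 ((of_int X)\<^sup>2 + (of_int Y)\<^sup>2 - 1) (Complex (of_int X) (of_int Y))"
  using circ_eq_ext_circle[OF _ grid_normalized[of X Y]] by simp

lemma grid_inversion_eq_hinv:
  "grid_inversion X Y = hinv 1 ((of_int X)\<^sup>2 + (of_int Y)\<^sup>2 - 1) (Complex (of_int X) (of_int Y))"
  using circle_inversion_eq_hinv[of 1 "Complex (of_int X) (of_int Y)" 1] by (simp add: cmod_power2)

lemma bij_grid_inversion: "bij (grid_inversion X Y)"
  unfolding grid_inversion_eq_hinv by (rule bij_hinv[OF grid_normalized])

lemma grid_inversion_involution: "grid_inversion X Y \<circ> grid_inversion X Y = id"
  unfolding grid_inversion_eq_hinv by (rule hinv_involution[OF grid_normalized])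

lemma represents_grid_circle:
  assumes "represents \<nu> \<phi>"
  obtains \<beta> \<gamma> where "(norm \<gamma>)\<^sup>2 - grid_value \<phi> X Y * \<beta> = 1"
    "\<nu> ` grid_circle X Y = circ (grid_value \<phi> X Y) \<beta> \<gamma>"
  using assms grid_normalized[of X Y] unfolding represents_def grid_circle_eq_circ grid_value_def by blast

text \<open>The inversion acts before \<open>\<nu>\<close>, so it changes the coordinates fed to
  \<open>\<phi>\<close> by a Lorentz reflection, and \<open>reflect\<close> moves this change to the
  functional.\<close>

lemma represents_reflect:
  assumes "represents \<nu> \<phi>"
  shows "represents (\<nu> \<circ> grid_inversion X Y) (reflect X Y \<phi>)"
  unfolding represents_def
proof (intro allI impI)
  fix \<alpha> \<beta> :: real and \<gamma> :: complex
  assume s: "(norm \<gamma>)\<^sup>2 - \<alpha> * \<beta> = 1"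
  define \<zeta> \<epsilon> where "\<zeta> = (real_of_int X)\<^sup>2 + (real_of_int Y)\<^sup>2 - 1" and "\<epsilon> = Complex (of_int X) (of_int Y)"
  have n: "(norm \<epsilon>)\<^sup>2 - 1 * \<zeta> = 1" unfolding \<zeta>_def \<epsilon>_def by (rule grid_normalized)
  define k where "k = 2 * Re (\<gamma> * cnj \<epsilon>) - \<alpha> * \<zeta> - \<beta> * 1"
  note h = hinv_image_circ[OF s n, folded k_def]
  have "apply_circ (reflect X Y \<phi>) \<alpha> \<beta> \<gamma> = apply_circ \<phi> (\<alpha> - k * 1) (\<beta> - k * \<zeta>) (\<gamma> - of_real k * \<epsilon>)"
    by (cases \<phi>) (simp add: k_def \<zeta>_def \<epsilon>_def grid_value_def Let_def power2_eq_square algebra_simps)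
  moreover have "(\<nu> \<circ> grid_inversion X Y) ` circ \<alpha> \<beta> \<gamma> = \<nu> ` circ (\<alpha> - k * 1) (\<beta> - k * \<zeta>) (\<gamma> - of_real k * \<epsilon>)"
  proof -
    have "grid_inversion X Y = hinv 1 \<zeta> \<epsilon>" unfolding \<zeta>_def \<epsilon>_def by (rule grid_inversion_eq_hinv)
    then show ?thesis unfolding image_comp[symmetric] h(2)[symmetric] by simp
  qed
  ultimately show "\<exists>\<beta>' \<gamma>'. (norm \<gamma>')\<^sup>2 - apply_circ (reflect X Y \<phi>) \<alpha> \<beta> \<gamma> * \<beta>' = 1 \<and>
       (\<nu> \<circ> grid_inversion X Y) ` circ \<alpha> \<beta> \<gamma> = circ (apply_circ (reflect X Y \<phi>) \<alpha> \<beta> \<gamma>) \<beta>' \<gamma>'"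
    using assms h(1) unfolding represents_def by simp
qed

text \<open>The circles are orthogonal, so the Lorentz product in the reflection formula is
  zero.\<close>

lemma grid_inversion_fixes:
  assumes "(U - X)\<^sup>2 + (V - Y)\<^sup>2 = 2"
  shows "grid_inversion X Y ` grid_circle U V = grid_circle U V"
proof -
  have "(real_of_int U - of_int X)\<^sup>2 + (of_int V - of_int Y)\<^sup>2 = of_int ((U - X)\<^sup>2 + (V - Y)\<^sup>2)" by simp
  also have "\<dots> = 2" using assms by simp
  finally have "2 * Re (Complex (of_int U) (of_int V) * cnj (Complex (of_int X) (of_int Y)))
      - 1 * ((of_int X)\<^sup>2 + (of_int Y)\<^sup>2 - 1) - ((of_int U)\<^sup>2 + (of_int V)\<^sup>2 - 1) * 1 = 0"
    by (simp add: power2_eq_square algebra_simps)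
  then show ?thesis
    using hinv_image_circ(2)[OF grid_normalized[of U V] grid_normalized[of X Y]]
    unfolding grid_inversion_eq_hinv grid_circle_eq_circ by simp
qed

text \<open>Two perpendicular unit vectors \<open>d\<close> and \<open>e\<close> along the axes, in
  either order and with arbitrary signs.\<close>

definition unit_frame :: "int \<Rightarrow> int \<Rightarrow> int \<Rightarrow> int \<Rightarrow> bool" where
  "unit_frame dx dy ex ey \<longleftrightarrow>
     \<bar>dx\<bar> = 1 \<and> dy = 0 \<and> ex = 0 \<and> \<bar>ey\<bar> = 1 \<or> dx = 0 \<and> \<bar>dy\<bar> = 1 \<and> \<bar>ex\<bar> = 1 \<and> ey = 0"

lemma adjacent_grid_circles:
  assumes "dx\<^sup>2 + dy\<^sup>2 = 1"
  shows "grid_circle X Y \<inter> grid_circle (X + 2 * dx) (Y + 2 * dy) =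
    {Some (Complex (of_int (X + dx)) (of_int (Y + dy)))}" (is "_ = {Some ?w}")
proof -
  have d: "(real_of_int dx)\<^sup>2 + (real_of_int dy)\<^sup>2 = 1"
    using assms by (metis of_int_add of_int_power of_int_1)
  have mem: "Some z \<in> grid_circle U V \<longleftrightarrow> (Re z - of_int U)\<^sup>2 + (Im z - of_int V)\<^sup>2 = 1" for z U V
  proof -
    have "Some z \<in> grid_circle U V \<longleftrightarrow> (dist z (Complex (of_int U) (of_int V)))\<^sup>2 = 1"
      by (auto simp: ext_circle_def dist_commute power2_eq_1_iff) (smt (verit) zero_le_dist)
    then show ?thesis by (simp add: dist_norm cmod_power2)
  qed
  have "z = ?w" if "Some z \<in> grid_circle X Y" "Some z \<in> grid_circle (X + 2 * dx) (Y + 2 * dy)" for z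
  proof -
    define u v where "u = Re z - of_int X" and "v = Im z - of_int Y"
    have 1: "u\<^sup>2 + v\<^sup>2 = 1" using that mem by (simp add: u_def v_def)
    have 2: "(u - 2 * of_int dx)\<^sup>2 + (v - 2 * of_int dy)\<^sup>2 = 1" using that(2)[unfolded mem] by (simp add: u_def v_def algebra_simps)
    \<comment> \<open>The parallelogram law: the squared distances to the two centres are both 1 and
      the centres are 2 apart, so the distance to the midpoint is zero.\<close>
    define S where "S = (u - of_int dx)\<^sup>2 + (v - of_int dy)\<^sup>2"
    have "2 * S = (u\<^sup>2 + v\<^sup>2) + ((u - 2 * of_int dx)\<^sup>2 + (v - 2 * of_int dy)\<^sup>2)
       - 2 * ((of_int dx)\<^sup>2 + (of_int dy)\<^sup>2)" by (simp add: S_def power2_eq_square algebra_simps)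
    then have "S = 0" unfolding 1 2 d by simp
    then have "u = of_int dx" "v = of_int dy" unfolding S_def by (simp_all add: sum_power2_eq_zero_iff)
    then show ?thesis by (simp add: u_def v_def complex_eq_iff)
  qed
  moreover have "Some ?w \<in> grid_circle X Y" "Some ?w \<in> grid_circle (X + 2 * dx) (Y + 2 * dy)"
    unfolding mem using d by simp_all
  moreover have "None \<notin> grid_circle X Y" by (auto simp: ext_circle_def)
  ultimately have "x \<in> grid_circle X Y \<inter> grid_circle (X + 2 * dx) (Y + 2 * dy) \<longleftrightarrow> x = Some ?w" for x
    by (cases x) blast+
  then show ?thesis by blast
qed

definition grid_divisible :: "int \<Rightarrow> functional \<Rightarrow> bool" where
  "grid_divisible m \<phi> \<longleftrightarrow> (\<forall>i j. \<exists>k. grid_value \<phi> (2 * i) (2 * j) = of_int (m * k))"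

text \<open>Eight times a value at a dual circle is an integral combination of values at grid
  circles, and the factor by which a reflection multiplies the dual value is divisible by 8.\<close>

lemma grid_divisible_reflect:
  assumes "grid_divisible m \<phi>" "odd X" "odd Y"
  shows "grid_divisible m (reflect X Y \<phi>)"
  unfolding grid_divisible_def
proof (intro allI)
  fix i j
  obtain x y where xy: "X = 2 * x + 1" "Y = 2 * y + 1" using assms(2,3) by (meson oddE)
  have g: "\<exists>k. grid_value \<phi> (2 * i) (2 * j) = of_int (m * k)" for i j
    using assms(1) unfolding grid_divisible_def by blast
  obtain k0 k1 k2 k3 k4 where k: "grid_value \<phi> (2 * x) (2 * y) = of_int (m * k0)"
    "grid_value \<phi> (2 * (x + 1)) (2 * y) = of_int (m * k1)" "grid_value \<phi> (2 * (x - 1)) (2 * y) = of_int (m * k2)"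
    "grid_value \<phi> (2 * x) (2 * (y + 1)) = of_int (m * k3)" "grid_value \<phi> (2 * i) (2 * j) = of_int (m * k4)"
    using g by meson
  have "8 * grid_value \<phi> X Y = 4 * grid_value \<phi> (2 * x) (2 * y) + 2 * grid_value \<phi> (2 * (x + 1)) (2 * y)
      + 4 * grid_value \<phi> (2 * x) (2 * (y + 1)) - 2 * grid_value \<phi> (2 * (x - 1)) (2 * y)"
    unfolding xy by (cases \<phi>) (simp add: grid_value_def power2_eq_square algebra_simps)
  then have e: "8 * grid_value \<phi> X Y = of_int (m * (4 * k0 + 2 * k1 + 4 * k3 - 2 * k2))"
    unfolding k by (simp add: algebra_simps)
  \<comment> \<open>Products of consecutive integers are even; this supplies the second factor 2
    beyond the 4 and hence the divisibility by 8.\<close>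
  have "even ((i - x) * (i - x - 1))" "even ((j - y) * (j - y - 1))" by auto
  then obtain u v where uv: "(i - x) * (i - x - 1) = 2 * u" "(j - y) * (j - y - 1) = 2 * v" by (meson evenE)
  have "(2 * i - X)\<^sup>2 + (2 * j - Y)\<^sup>2 - 2 = 4 * ((i - x) * (i - x - 1)) + 4 * ((j - y) * (j - y - 1))"
    unfolding xy by (simp add: power2_eq_square algebra_simps)
  also have "\<dots> = 8 * (u + v)" unfolding uv by simp
  finally have "real_of_int ((2 * i - X)\<^sup>2 + (2 * j - Y)\<^sup>2 - 2) = of_int (8 * (u + v))"
    by (simp only:)
  then have "(real_of_int (2 * i - X))\<^sup>2 + (of_int (2 * j - Y))\<^sup>2 - 2 = of_int (8 * (u + v))"
    by simp
  then have "grid_value (reflect X Y \<phi>) (2 * i) (2 * j) =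
      grid_value \<phi> (2 * i) (2 * j) + of_int (u + v) * (8 * grid_value \<phi> X Y)"
    unfolding grid_value_reflect by simp
  also have "\<dots> = of_int (m * (k4 + (u + v) * (4 * k0 + 2 * k1 + 4 * k3 - 2 * k2)))"
    unfolding e k by (simp add: algebra_simps)
  finally show "\<exists>k. grid_value (reflect X Y \<phi>) (2 * i) (2 * j) = of_int (m * k)" by blast
qed

text \<open>The grid values form a quadratic polynomial without mixed term, so they are interpolated
  from a centre and its four neighbours. The coefficients \<open>u (u + 1) / 2\<close> and
  \<open>u (u - 1) / 2\<close> are integers.\<close>

lemma grid_divisibleI:
  assumes "grid_value \<phi> (2 * i) (2 * j) = of_int (m * k0)"
    "grid_value \<phi> (2 * i + 2) (2 * j) = of_int (m * k1)" "grid_value \<phi> (2 * i - 2) (2 * j) = of_int (m * k2)"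
    "grid_value \<phi> (2 * i) (2 * j + 2) = of_int (m * k3)" "grid_value \<phi> (2 * i) (2 * j - 2) = of_int (m * k4)"
  shows "grid_divisible m \<phi>"
  unfolding grid_divisible_def
proof (intro allI)
  fix x y
  define u v where "u = x - i" and "v = y - j"
  have xy: "x = i + u" "y = j + v" by (simp_all add: u_def v_def)
  have "even (u * (u + 1))" "even (u * (u - 1))" "even (v * (v + 1))" "even (v * (v - 1))" by auto
  then obtain u1 u2 v1 v2 where h: "u * (u + 1) = 2 * u1" "u * (u - 1) = 2 * u2" "v * (v + 1) = 2 * v1" "v * (v - 1) = 2 * v2"
    by (meson evenE)
  have h': "of_int u * (of_int u + 1) = 2 * real_of_int u1" "of_int u * (of_int u - 1) = 2 * real_of_int u2"
     "of_int v * (of_int v + 1) = 2 * real_of_int v1" "of_int v * (of_int v - 1) = 2 * real_of_int v2"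
    using h[THEN arg_cong[where f = real_of_int]] by simp_all
  have "2 * grid_value \<phi> (2 * x) (2 * y) = 2 * grid_value \<phi> (2 * i) (2 * j) * (1 - (of_int u)\<^sup>2 - (of_int v)\<^sup>2)
    + (of_int u * (of_int u + 1)) * grid_value \<phi> (2 * i + 2) (2 * j) + (of_int u * (of_int u - 1)) * grid_value \<phi> (2 * i - 2) (2 * j)
    + (of_int v * (of_int v + 1)) * grid_value \<phi> (2 * i) (2 * j + 2) + (of_int v * (of_int v - 1)) * grid_value \<phi> (2 * i) (2 * j - 2)"
    unfolding xy by (cases \<phi>) (simp add: grid_value_def power2_eq_square algebra_simps)
  then have "grid_value \<phi> (2 * x) (2 * y) = of_int (m * (k0 * (1 - u\<^sup>2 - v\<^sup>2) + u1 * k1 + u2 * k2 + v1 * k3 + v2 * k4))"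
    unfolding h' assms by (simp add: algebra_simps)
  then show "\<exists>k. grid_value \<phi> (2 * x) (2 * y) = of_int (m * k)" by blast
qed

section \<open>Words in the inversions of the grid\<close>

text \<open>New inversions are appended on the right and always taken in circles of the fixed grid;
  this matches \<open>represents_reflect\<close>, so the functional is updated by one
  \<open>reflect\<close> per letter.\<close>

inductive word :: "functional \<Rightarrow> (ext_plane \<Rightarrow> ext_plane) \<Rightarrow> functional \<Rightarrow> bool" for \<phi>\<^sub>0 where
  word_id: "word \<phi>\<^sub>0 id \<phi>\<^sub>0"
| word_step: "word \<phi>\<^sub>0 h \<phi> \<Longrightarrow> odd X \<Longrightarrow> odd Y \<Longrightarrow> word \<phi>\<^sub>0 (h \<circ> grid_inversion X Y) (reflect X Y \<phi>)"

lemma word_comp: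
  assumes "word \<phi>\<^sub>0 g \<phi>" "word \<phi>\<^sub>0 h \<phi>'"
  shows "\<exists>\<phi>''. word \<phi>\<^sub>0 (g \<circ> h) \<phi>''"
  using assms(2)
proof induction
  case word_id
  then show ?case using assms(1) by (intro exI[of _ \<phi>]) simp
next
  case (word_step h \<phi> X Y)
  then show ?case using word.word_step by (metis comp_assoc)
qed

lemma word_inverse:
  assumes "word \<phi>\<^sub>0 h \<phi>"
  shows "\<exists>h' \<phi>'. word \<phi>\<^sub>0 h' \<phi>' \<and> h \<circ> h' = id"
  using assms
proof induction
  case word_id
  then show ?case using word.word_id by (metis comp_id)
next
  case (word_step h \<phi> X Y)
  then obtain h' \<phi>' where h': "word \<phi>\<^sub>0 h' \<phi>'" "h \<circ> h' = id" by blast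
  have "word \<phi>\<^sub>0 (id \<circ> grid_inversion X Y) (reflect X Y \<phi>\<^sub>0)"
    using word_step word.word_step word.word_id by blast
  then have "word \<phi>\<^sub>0 (grid_inversion X Y) (reflect X Y \<phi>\<^sub>0)" by simp
  from word_comp[OF this h'(1)] obtain \<phi>'' where "word \<phi>\<^sub>0 (grid_inversion X Y \<circ> h') \<phi>''" by blast
  moreover have "(h \<circ> grid_inversion X Y) \<circ> (grid_inversion X Y \<circ> h') = h \<circ> (grid_inversion X Y \<circ> grid_inversion X Y) \<circ> h'"
    by (simp only: comp_assoc)
  then have "(h \<circ> grid_inversion X Y) \<circ> (grid_inversion X Y \<circ> h') = id"
    unfolding grid_inversion_involution using h'(2) by simp
  ultimately show ?case by blast
qed

lemma bij_word: "word \<phi>\<^sub>0 h \<phi> \<Longrightarrow> bij h"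
  by (induction rule: word.induct) (rule bij_id, blast intro: bij_comp bij_grid_inversion)

lemma isotropic_word: "word \<phi>\<^sub>0 h \<phi> \<Longrightarrow> isotropic \<phi>\<^sub>0 \<Longrightarrow> isotropic \<phi>"
  by (induction rule: word.induct) (simp_all add: isotropic_reflect)

lemma represents_word:
  assumes "word \<phi>\<^sub>0 h \<phi>" "represents \<mu> \<phi>\<^sub>0" shows "represents (\<mu> \<circ> h) \<phi>"
  using assms by induction (auto simp: comp_assoc[symmetric] intro: represents_reflect)

text \<open>Divisibility survives each reflection, and in both directions because reflections are
  involutions.\<close>

lemma grid_divisible_word:
  assumes "word \<phi>\<^sub>0 h \<phi>" shows "grid_divisible m \<phi> \<longleftrightarrow> grid_divisible m \<phi>\<^sub>0"
  using assms
proof induction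
  case (word_step h \<phi> X Y)
  have "grid_divisible m (reflect X Y \<phi>) \<longleftrightarrow> grid_divisible m \<phi>"
    using grid_divisible_reflect[of m \<phi> X Y] grid_divisible_reflect[of m "reflect X Y \<phi>" X Y] word_step.hyps
    by (auto simp: reflect_reflect)
  then show ?case using word_step by simp
qed simp

section \<open>The packing as image of the grid under words\<close>

locale moebius_packing =
  fixes a b c d :: complex
  assumes det: "a * d - b * c \<noteq> 0"
begin

definition \<mu> :: "ext_plane \<Rightarrow> ext_plane" where "\<mu> = moebius a b c d"

text \<open>The coefficients of \<open>\<alpha>'\<close> in \<open>moebius_image_circ\<close>. For
  \<open>c \<noteq> 0\<close> this is, up to a positive factor, the equation of the circle evaluated
  at \<open>- d / c\<close>, the preimage of infinity.\<close>

definition base :: functional where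
  "base = (let k = norm (a * d - b * c) in
     ((norm d)\<^sup>2 / k, (norm c)\<^sup>2 / k, 2 * Re (d * cnj c) / k, 2 * Im (d * cnj c) / k))"

lemma bij_mu: "bij \<mu>"
  unfolding \<mu>_def by (rule bij_moebius[OF det])

lemma represents_base: "represents \<mu> base"
  unfolding represents_def
proof (intro allI impI)
  fix \<alpha> \<beta> :: real and \<gamma> :: complex
  assume s: "(norm \<gamma>)\<^sup>2 - \<alpha> * \<beta> = 1"
  have "apply_circ base \<alpha> \<beta> \<gamma> = ((norm d)\<^sup>2 * \<alpha> + (norm c)\<^sup>2 * \<beta> + 2 * Re (cnj \<gamma> * (d * cnj c))) / norm (a * d - b * c)"
    by (simp add: base_def Let_def add_divide_distrib diff_divide_distrib algebra_simps)
  then show "\<exists>\<beta>' \<gamma>'. (norm \<gamma>')\<^sup>2 - apply_circ base \<alpha> \<beta> \<gamma> * \<beta>' = 1 \<and>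
       \<mu> ` circ \<alpha> \<beta> \<gamma> = circ (apply_circ base \<alpha> \<beta> \<gamma>) \<beta>' \<gamma>'"
    using moebius_image_circ[OF det s] unfolding \<mu>_def by metis
qed

lemma isotropic_base: "isotropic base"
proof -
  have "(Re (d * cnj c))\<^sup>2 + (Im (d * cnj c))\<^sup>2 = (norm d)\<^sup>2 * (norm c)\<^sup>2"
    by (metis cmod_power2 complex_mod_cnj norm_mult power_mult_distrib)
  moreover have "(2 * r / k)\<^sup>2 + (2 * i / k)\<^sup>2 = 4 * (r\<^sup>2 + i\<^sup>2) / k\<^sup>2" for r i k :: real
    by (simp add: power_divide power_mult_distrib add_divide_distrib)
  ultimately show ?thesis unfolding base_def Let_def isotropic.simps
    by (simp only:) (simp add: power2_eq_square)
qed

lemma inversion_in_dual: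
  shows "\<exists>\<sigma>. is_inversion_in (\<mu> ` grid_circle X Y) \<sigma>"
    and "is_inversion_in (\<mu> ` grid_circle X Y) \<sigma> \<Longrightarrow> \<sigma> \<circ> \<mu> = \<mu> \<circ> grid_inversion X Y"
proof -
  obtain \<alpha> \<beta> \<gamma> where s: "(norm \<gamma>)\<^sup>2 - \<alpha> * \<beta> = 1" and i: "\<mu> \<circ> grid_inversion X Y = hinv \<alpha> \<beta> \<gamma> \<circ> \<mu>"
    and D: "\<mu> ` grid_circle X Y = circ \<alpha> \<beta> \<gamma>"
    using moebius_image_circ[OF det grid_normalized[of X Y]]
    unfolding \<mu>_def grid_circle_eq_circ grid_inversion_eq_hinv by blast
  show "\<exists>\<sigma>. is_inversion_in (\<mu> ` grid_circle X Y) \<sigma>" unfolding D using is_inversion_in_circ[OF s] by blast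
  show "\<sigma> \<circ> \<mu> = \<mu> \<circ> grid_inversion X Y" if "is_inversion_in (\<mu> ` grid_circle X Y) \<sigma>"
    using is_inversion_in_unique[OF _ s] that i unfolding D by simp
qed

lemma dual_circles_eq: "dual_circles \<mu> = {\<mu> ` grid_circle X Y | X Y. odd X \<and> odd Y}"
proof (intro equalityI subsetI)
  fix D assume "D \<in> dual_circles \<mu>"
  then obtain i j where "D = \<mu> ` grid_circle (2 * i + 1) (2 * j + 1)" unfolding dual_circles_def by blast
  moreover have "odd (2 * i + 1)" "odd (2 * j + 1)" by simp_all
  ultimately show "D \<in> {\<mu> ` grid_circle X Y | X Y. odd X \<and> odd Y}" by blast
next
  fix D assume "D \<in> {\<mu> ` grid_circle X Y | X Y. odd X \<and> odd Y}"
  then obtain X Y where "D = \<mu> ` grid_circle X Y" "odd X" "odd Y" by blast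
  moreover then obtain i j where "X = 2 * i + 1" "Y = 2 * j + 1" by (meson oddE)
  ultimately show "D \<in> dual_circles \<mu>" unfolding dual_circles_def by blast
qed

text \<open>Conjugation by \<open>\<mu>\<close> turns an inversion in a dual circle into one in a
  circle of the grid, so group elements correspond to words.\<close>

lemma group_word:
  assumes "g \<in> square_apollonian_group \<mu>"
  shows "\<exists>h \<phi>. word base h \<phi> \<and> g \<circ> \<mu> = \<mu> \<circ> h"
  using assms
proof induction
  case (generator D \<sigma>)
  then obtain X Y where XY: "D = \<mu> ` grid_circle X Y" "odd X" "odd Y" unfolding dual_circles_eq by blast
  then have "\<sigma> \<circ> \<mu> = \<mu> \<circ> (id \<circ> grid_inversion X Y)" using generator(2) inversion_in_dual(2) by simp
  then show ?case using word_step[OF word_id XY(2,3)] by blast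
next
  case identity
  then show ?case using word_id by fastforce
next
  case (composition g h)
  then obtain u \<phi> v \<phi>' where u: "word base u \<phi>" "g \<circ> \<mu> = \<mu> \<circ> u" and v: "word base v \<phi>'" "h \<circ> \<mu> = \<mu> \<circ> v" by blast
  have "(g \<circ> h) \<circ> \<mu> = \<mu> \<circ> (u \<circ> v)" using u(2) v(2) by (metis comp_assoc)
  then show ?case using word_comp[OF u(1) v(1)] by blast
next
  case (inverse g)
  then obtain h \<phi> where h: "word base h \<phi>" "g \<circ> \<mu> = \<mu> \<circ> h" by blast
  obtain h' \<phi>' where h': "word base h' \<phi>'" "h \<circ> h' = id" using word_inverse[OF h(1)] by blast
  \<comment> \<open>\<open>inv_into\<close> is a genuine inverse only for injective
    \<open>g\<close>; this follows from the bijectivity of \<open>\<mu>\<close> and of the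
    word.\<close>
  have "bij (g \<circ> \<mu>)" unfolding h(2) using bij_mu bij_word[OF h(1)] by (simp add: bij_comp)
  then have "inj g" using bij_mu by (metis bij_betw_def bij_is_surj inj_on_imageI)
  have "inv_into UNIV g (\<mu> x) = \<mu> (h' x)" for x
  proof -
    have "g (\<mu> (h' x)) = \<mu> (h (h' x))" using fun_cong[OF h(2), of "h' x"] by simp
    also have "\<dots> = \<mu> x" using fun_cong[OF h'(2), of x] by simp
    finally show ?thesis using \<open>inj g\<close> by (simp add: inv_f_eq)
  qed
  then have "inv_into UNIV g \<circ> \<mu> = \<mu> \<circ> h'" by auto
  then show ?case using h'(1) by blast
qed

lemma word_group:
  assumes "word base h \<phi>"
  shows "\<exists>g \<in> square_apollonian_group \<mu>. g \<circ> \<mu> = \<mu> \<circ> h"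
  using assms
proof induction
  case word_id
  then show ?case using square_apollonian_group.identity by (intro bexI[of _ id]) auto
next
  case (word_step h \<phi> X Y)
  then obtain g where g: "g \<in> square_apollonian_group \<mu>" "g \<circ> \<mu> = \<mu> \<circ> h" by blast
  obtain \<sigma> where \<sigma>: "is_inversion_in (\<mu> ` grid_circle X Y) \<sigma>" using inversion_in_dual(1) by blast
  have "\<mu> ` grid_circle X Y \<in> dual_circles \<mu>" unfolding dual_circles_eq using word_step by blast
  then have "\<sigma> \<in> square_apollonian_group \<mu>" using \<sigma> by (rule square_apollonian_group.generator)
  moreover have "(g \<circ> \<sigma>) \<circ> \<mu> = \<mu> \<circ> (h \<circ> grid_inversion X Y)"
    using inversion_in_dual(2)[OF \<sigma>] g(2) by (metis comp_assoc)
  ultimately show ?case using g(1) square_apollonian_group.composition by blast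
qed

lemma packing_eq:
  "square_packing_of \<mu> = {(\<mu> \<circ> h) ` grid_circle (2 * i) (2 * j) | h \<phi> i j. word base h \<phi>}"
proof (intro equalityI subsetI)
  fix C assume "C \<in> square_packing_of \<mu>"
  then obtain g i j where g: "g \<in> square_apollonian_group \<mu>" "C = g ` \<mu> ` grid_circle (2 * i) (2 * j)"
    unfolding square_packing_of_def square_configuration_def by blast
  then obtain h \<phi> where h: "word base h \<phi>" "g \<circ> \<mu> = \<mu> \<circ> h" using group_word by blast
  have "C = (\<mu> \<circ> h) ` grid_circle (2 * i) (2 * j)"
    unfolding h(2)[symmetric] g(2) by (rule image_comp)
  then show "C \<in> {(\<mu> \<circ> h) ` grid_circle (2 * i) (2 * j) | h \<phi> i j. word base h \<phi>}"
    using h(1) by blast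
next
  fix C assume "C \<in> {(\<mu> \<circ> h) ` grid_circle (2 * i) (2 * j) | h \<phi> i j. word base h \<phi>}"
  then obtain h \<phi> i j where h: "C = (\<mu> \<circ> h) ` grid_circle (2 * i) (2 * j)" "word base h \<phi>" by blast
  then obtain g where g: "g \<in> square_apollonian_group \<mu>" "g \<circ> \<mu> = \<mu> \<circ> h" using word_group by blast
  have "C = g ` \<mu> ` grid_circle (2 * i) (2 * j)" unfolding h(1) g(2)[symmetric] by (simp add: image_comp)
  then show "C \<in> square_packing_of \<mu>"
    using g(1) unfolding square_packing_of_def square_configuration_def by blast
qed

lemma abs_curvature_word:
  assumes "word base h \<phi>"
  shows "\<bar>curvature P ((\<mu> \<circ> h) ` grid_circle X Y)\<bar> = \<bar>grid_value \<phi> X Y\<bar>"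
proof -
  obtain \<beta> \<gamma> where "(norm \<gamma>)\<^sup>2 - grid_value \<phi> X Y * \<beta> = 1"
    "(\<mu> \<circ> h) ` grid_circle X Y = circ (grid_value \<phi> X Y) \<beta> \<gamma>"
    by (rule represents_grid_circle[OF represents_word[OF assms represents_base]])
  then show ?thesis using abs_curvature_circ by simp
qed

lemma tangent_word:
  assumes "word base h \<phi>" "dx\<^sup>2 + dy\<^sup>2 = 1"
  shows "tangent ((\<mu> \<circ> h) ` grid_circle X Y) ((\<mu> \<circ> h) ` grid_circle (X + 2 * dx) (Y + 2 * dy))"
proof -
  have "inj (\<mu> \<circ> h)" using bij_mu bij_word[OF assms(1)] by (simp add: bij_comp bij_is_inj)
  note image_Int[OF this, of "grid_circle X Y" "grid_circle (X + 2 * dx) (Y + 2 * dy)", symmetric]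
  then show ?thesis unfolding tangent_def adjacent_grid_circles[OF assms(2)] image_insert image_empty by (rule exI)
qed

section \<open>The binary forms attached to a circle\<close>

text \<open>The circle \<open>C\<close> is fixed while the word \<open>h\<close> placing it at
  \<open>(X, Y)\<close> may vary. The outer coefficients add the value at \<open>C\<close> to those
  of the neighbours in the directions \<open>d\<close> and \<open>- d\<close>; \<open>K\<close> is
  half the difference of the neighbours in the perpendicular directions.\<close>

definition form_at :: "ext_plane set \<Rightarrow> int \<Rightarrow> int \<Rightarrow> int \<Rightarrow> int \<Rightarrow> int \<Rightarrow> int \<Rightarrow> bool" where
  "form_at C X Y A P K R \<longleftrightarrow> (\<exists>h \<phi> dx dy ex ey. word base h \<phi> \<and> unit_frame dx dy ex ey \<and>
     (\<mu> \<circ> h) ` grid_circle X Y = C \<and> grid_value \<phi> X Y = of_int A \<and>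
     of_int P = grid_value \<phi> X Y + grid_value \<phi> (X + 2 * dx) (Y + 2 * dy) \<and>
     of_int R = grid_value \<phi> X Y + grid_value \<phi> (X - 2 * dx) (Y - 2 * dy) \<and>
     2 * of_int K = grid_value \<phi> (X + 2 * ex) (Y + 2 * ey) - grid_value \<phi> (X - 2 * ex) (Y - 2 * ey))"

lemma form_at_neg:
  assumes "form_at C X Y A P K R" shows "form_at C X Y A P (- K) R"
proof -
  obtain h \<phi> dx dy ex ey where w: "word base h \<phi>" "unit_frame dx dy ex ey"
    "(\<mu> \<circ> h) ` grid_circle X Y = C" "grid_value \<phi> X Y = of_int A"
    "of_int P = grid_value \<phi> X Y + grid_value \<phi> (X + 2 * dx) (Y + 2 * dy)"
    "of_int R = grid_value \<phi> X Y + grid_value \<phi> (X - 2 * dx) (Y - 2 * dy)"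
    "2 * of_int K = grid_value \<phi> (X + 2 * ex) (Y + 2 * ey) - grid_value \<phi> (X - 2 * ex) (Y - 2 * ey)"
    using assms unfolding form_at_def by blast
  have "unit_frame dx dy (- ex) (- ey)" using w(2) by (auto simp: unit_frame_def)
  then show ?thesis unfolding form_at_def using w
    by (intro exI[of _ h] exI[of _ \<phi>] exI[of _ dx] exI[of _ dy] exI[of _ "- ex"] exI[of _ "- ey"]) simp
qed

lemma form_at_swap:
  assumes "form_at C X Y A P K R" shows "form_at C X Y A R K P"
proof -
  obtain h \<phi> dx dy ex ey where w: "word base h \<phi>" "unit_frame dx dy ex ey"
    "(\<mu> \<circ> h) ` grid_circle X Y = C" "grid_value \<phi> X Y = of_int A"
    "of_int P = grid_value \<phi> X Y + grid_value \<phi> (X + 2 * dx) (Y + 2 * dy)"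
    "of_int R = grid_value \<phi> X Y + grid_value \<phi> (X - 2 * dx) (Y - 2 * dy)"
    "2 * of_int K = grid_value \<phi> (X + 2 * ex) (Y + 2 * ey) - grid_value \<phi> (X - 2 * ex) (Y - 2 * ey)"
    using assms unfolding form_at_def by blast
  have "unit_frame (- dx) (- dy) ex ey" using w(2) by (auto simp: unit_frame_def)
  then show ?thesis unfolding form_at_def using w
    by (intro exI[of _ h] exI[of _ \<phi>] exI[of _ "- dx"] exI[of _ "- dy"] exI[of _ ex] exI[of _ ey]) simp
qed

text \<open>One Euclidean step is the inversion in the dual circle at the corner between the
  directions \<open>d\<close> and \<open>e\<close>. It is orthogonal to \<open>C\<close> and to the
  neighbours in these directions, so it moves only the two opposite neighbours.\<close>

lemma form_at_reflect:
  assumes "form_at C X Y A P K R" "even X" "even Y"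
  shows "form_at C X Y A P (- 2 * P - K) (4 * P + 4 * K + R)"
proof -
  obtain h \<phi> dx dy ex ey where w: "word base h \<phi>" "unit_frame dx dy ex ey"
    "(\<mu> \<circ> h) ` grid_circle X Y = C" "grid_value \<phi> X Y = of_int A"
    and P: "of_int P = grid_value \<phi> X Y + grid_value \<phi> (X + 2 * dx) (Y + 2 * dy)"
    and R: "of_int R = grid_value \<phi> X Y + grid_value \<phi> (X - 2 * dx) (Y - 2 * dy)"
    and K: "2 * of_int K = grid_value \<phi> (X + 2 * ex) (Y + 2 * ey) - grid_value \<phi> (X - 2 * ex) (Y - 2 * ey)"
    using assms unfolding form_at_def by blast
  define U V where "U = X + dx + ex" and "V = Y + dy + ey"
  have frame: "(dx = 1 \<or> dx = -1) \<and> dy = 0 \<and> ex = 0 \<and> (ey = 1 \<or> ey = -1) \<or>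
      dx = 0 \<and> (dy = 1 \<or> dy = -1) \<and> (ex = 1 \<or> ex = -1) \<and> ey = 0"
    using w(2) unfolding unit_frame_def by linarith
  have odd: "odd U" "odd V" using frame assms(2,3) by (auto simp: U_def V_def)
  have v: "grid_value (reflect U V \<phi>) X Y = grid_value \<phi> X Y"
    "grid_value (reflect U V \<phi>) (X + 2 * dx) (Y + 2 * dy) = grid_value \<phi> (X + 2 * dx) (Y + 2 * dy)"
    "grid_value (reflect U V \<phi>) (X + 2 * ex) (Y + 2 * ey) = grid_value \<phi> (X + 2 * ex) (Y + 2 * ey)"
    "grid_value (reflect U V \<phi>) (X - 2 * dx) (Y - 2 * dy) = grid_value \<phi> (X - 2 * dx) (Y - 2 * dy) + 8 * grid_value \<phi> U V"
    "grid_value (reflect U V \<phi>) (X - 2 * ex) (Y - 2 * ey) = grid_value \<phi> (X - 2 * ex) (Y - 2 * ey) + 8 * grid_value \<phi> U V"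
    unfolding grid_value_reflect using frame by (auto simp: U_def V_def)
  \<comment> \<open>The values on the grid depend on four parameters, so the value at the dual
    circle is a combination of four grid values.\<close>
  have e: "8 * grid_value \<phi> U V = 4 * grid_value \<phi> X Y + 2 * grid_value \<phi> (X + 2 * dx) (Y + 2 * dy)
      + 4 * grid_value \<phi> (X + 2 * ex) (Y + 2 * ey) - 2 * grid_value \<phi> (X - 2 * dx) (Y - 2 * dy)"
    using frame unfolding U_def V_def
    by (cases \<phi>) (auto simp: grid_value_def power2_eq_square algebra_simps)
  have s: "grid_value \<phi> (X + 2 * ex) (Y + 2 * ey) + grid_value \<phi> (X - 2 * ex) (Y - 2 * ey) =
     grid_value \<phi> (X + 2 * dx) (Y + 2 * dy) + grid_value \<phi> (X - 2 * dx) (Y - 2 * dy)"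
    using frame by (cases \<phi>) (auto simp: grid_value_def power2_eq_square algebra_simps)
  have "grid_inversion U V ` grid_circle X Y = grid_circle X Y"
    by (rule grid_inversion_fixes) (use frame in \<open>auto simp: U_def V_def\<close>)
  then have C: "(\<mu> \<circ> (h \<circ> grid_inversion U V)) ` grid_circle X Y = C"
    using w(3) by (metis comp_assoc image_comp)
  \<comment> \<open>By \<open>s\<close> and \<open>K\<close>, the right side of \<open>e\<close>
    becomes \<open>4 P + 4 K\<close>. This is the amount added to \<open>R\<close>, and half of it
    is subtracted from \<open>K\<close>.\<close>
  show ?thesis unfolding form_at_def
    using word_step[OF w(1) odd] w(2,4) C P R K s e
    by (intro exI[of _ "h \<circ> grid_inversion U V"] exI[of _ "reflect U V \<phi>"] exI[of _ dx] exI[of _ dy] exI[of _ ex] exI[of _ ey])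
      (simp add: v)
qed

lemma form_at_neighbour:
  assumes "form_at C X Y A P K R" "even X" "even Y"
  shows "\<exists>C' \<in> square_packing_of \<mu>. tangent C C' \<and> (\<forall>Q. \<bar>curvature Q C'\<bar> = of_int \<bar>P - A\<bar>)"
proof -
  obtain h \<phi> dx dy ex ey where w: "word base h \<phi>" "unit_frame dx dy ex ey"
    "(\<mu> \<circ> h) ` grid_circle X Y = C" "grid_value \<phi> X Y = of_int A"
    and P: "of_int P = grid_value \<phi> X Y + grid_value \<phi> (X + 2 * dx) (Y + 2 * dy)"
    using assms unfolding form_at_def by blast
  let ?C = "(\<mu> \<circ> h) ` grid_circle (X + 2 * dx) (Y + 2 * dy)"
  have d: "dx\<^sup>2 + dy\<^sup>2 = 1" using w(2) by (auto simp: unit_frame_def power2_eq_1_iff abs_eq_iff')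
  obtain i j where "X = 2 * i" "Y = 2 * j" using assms(2,3) by (meson evenE)
  then have "?C = (\<mu> \<circ> h) ` grid_circle (2 * (i + dx)) (2 * (j + dy))" by (simp add: algebra_simps)
  then have "?C \<in> square_packing_of \<mu>" unfolding packing_eq using w(1) by blast
  moreover have "tangent C ?C" using tangent_word[OF w(1) d, of X Y] w(3) by simp
  moreover have "grid_value \<phi> (X + 2 * dx) (Y + 2 * dy) = of_int (P - A)" using P w(4) by simp
  then have "\<bar>curvature Q ?C\<bar> = of_int \<bar>P - A\<bar>" for Q
    unfolding abs_curvature_word[OF w(1)] by simp
  ultimately show ?thesis by blast
qed

text \<open>The descent is run on all forms attached to \<open>C\<close>. Form values are sums of
  two curvatures, hence the subtraction of \<open>A\<close>.\<close>

lemma neighbour_curvatures: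
  assumes "form_at C X Y A P K R" "even X" "even Y" "coprime x y" "odd (x + y)"
  shows "\<exists>C' \<in> square_packing_of \<mu>. tangent C C' \<and>
    (\<forall>Q. \<bar>curvature Q C'\<bar> = of_int \<bar>P * x\<^sup>2 + 2 * K * x * y + R * y\<^sup>2 - A\<bar>)"
proof (rule binary_form_descent[where Q = "form_at C X Y A" and N = "\<lambda>P. \<exists>C' \<in> square_packing_of \<mu>. tangent C C' \<and>
      (\<forall>Q. \<bar>curvature Q C'\<bar> = of_int \<bar>P - A\<bar>)", OF _ _ _ _ assms(1,4,5)])
  fix P K R assume f: "form_at C X Y A P K R"
  show "\<exists>C' \<in> square_packing_of \<mu>. tangent C C' \<and> (\<forall>Q. \<bar>curvature Q C'\<bar> = of_int \<bar>P - A\<bar>)"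
    by (rule form_at_neighbour[OF f assms(2,3)])
  show "form_at C X Y A P (- K) R" by (rule form_at_neg[OF f])
  show "form_at C X Y A R K P" by (rule form_at_swap[OF f])
  show "form_at C X Y A P (- 2 * P - K) (4 * P + 4 * K + R)" by (rule form_at_reflect[OF f assms(2,3)])
qed

lemma integral_grid_value:
  assumes "is_integral_packing (square_packing_of \<mu>)" "word base h \<phi>"
  shows "\<exists>k. grid_value \<phi> (2 * i) (2 * j) = of_int k"
proof -
  let ?P = "square_packing_of \<mu>" and ?C = "(\<mu> \<circ> h) ` grid_circle (2 * i) (2 * j)"
  have "?C \<in> ?P" using assms(2) unfolding packing_eq by blast
  then have "\<bar>curvature ?P ?C\<bar> \<in> \<int>" using assms(1) unfolding is_integral_packing_def by simp
  then have "\<bar>grid_value \<phi> (2 * i) (2 * j)\<bar> \<in> \<int>" unfolding abs_curvature_word[OF assms(2)] .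
  then show ?thesis by (auto simp: abs_if minus_in_Ints_iff elim: Ints_cases split: if_splits)
qed

text \<open>Divisibility passes along words from one functional to all others, so \<open>m\<close>
  would divide every curvature of the packing.\<close>

lemma primitive_not_grid_divisible:
  assumes "is_primitive_packing (square_packing_of \<mu>)" "prime m" "word base h \<phi>"
  shows "\<not> grid_divisible m \<phi>"
proof
  assume *: "grid_divisible m \<phi>"
  let ?P = "square_packing_of \<mu>"
  have "m dvd k" if k: "k \<in> curvatures ?P" for k
  proof -
    obtain C where C: "C \<in> ?P" "curvature ?P C = of_int k" using k unfolding curvatures_def by blast
    then obtain g \<psi> i j where g: "C = (\<mu> \<circ> g) ` grid_circle (2 * i) (2 * j)" "word base g \<psi>" unfolding packing_eq by blast
    have "grid_divisible m \<psi>" using * grid_divisible_word[OF assms(3)] grid_divisible_word[OF g(2)] by blast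
    then obtain l where l: "grid_value \<psi> (2 * i) (2 * j) = of_int (m * l)" unfolding grid_divisible_def by blast
    have "\<bar>curvature ?P C\<bar> = \<bar>grid_value \<psi> (2 * i) (2 * j)\<bar>" unfolding g(1) by (rule abs_curvature_word[OF g(2)])
    then have "real_of_int \<bar>k\<bar> = of_int \<bar>m * l\<bar>" unfolding C(2) l by simp
    then have "\<bar>k\<bar> = \<bar>m * l\<bar>" by (simp only: of_int_eq_iff)
    then show "m dvd k" by (metis dvd_abs_iff dvd_triv_left)
  qed
  then have "m dvd Gcd (curvatures ?P)" by (rule Gcd_greatest)
  then have "m dvd 1" using assms(1) unfolding is_primitive_packing_def by simp
  then show False using assms(2) by (meson not_prime_unit)
qed

lemma exists_coprime_tangent:
  assumes "is_integral_packing (square_packing_of \<mu>)" "is_primitive_packing (square_packing_of \<mu>)"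
    and "C \<in> square_packing_of \<mu>" "curvature (square_packing_of \<mu>) C = of_int n"
  shows "\<exists>C' \<in> square_packing_of \<mu>. \<exists>m. tangent C C' \<and>
    curvature (square_packing_of \<mu>) C' = of_int m \<and> coprime n m"
proof -
  let ?P = "square_packing_of \<mu>"
  obtain h \<phi> i j where C: "(\<mu> \<circ> h) ` grid_circle (2 * i) (2 * j) = C" and w: "word base h \<phi>"
    using assms(3) unfolding packing_eq by blast
  define v where "v = (\<lambda>x y. grid_value \<phi> (2 * x) (2 * y))"
  have int: "\<exists>k. v x y = of_int k" for x y unfolding v_def by (rule integral_grid_value[OF assms(1) w])
  obtain A k1 k2 k3 k4 where k: "v i j = of_int A" "v (i + 1) j = of_int k1" "v (i - 1) j = of_int k2"
    "v i (j + 1) = of_int k3" "v i (j - 1) = of_int k4" using int by meson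
  define P1 P2 P3 P4 where "P1 = A + k1" and "P2 = A + k2" and "P3 = A + k3" and "P4 = A + k4"
  note Pdefs = this
  have V: "grid_value \<phi> (2 * i) (2 * j) = of_int A" "grid_value \<phi> (2 * i + 2) (2 * j) = of_int k1"
    "grid_value \<phi> (2 * i - 2) (2 * j) = of_int k2" "grid_value \<phi> (2 * i) (2 * j + 2) = of_int k3"
    "grid_value \<phi> (2 * i) (2 * j - 2) = of_int k4"
    using k by (simp_all add: v_def algebra_simps)
  obtain p q s t where \<phi>: "\<phi> = (p, q, s, t)" by (cases \<phi>)
  have iso: "s\<^sup>2 + t\<^sup>2 = 4 * p * q" using isotropic_word[OF w isotropic_base] \<phi> by simp
  define x y where "x = 2 * real_of_int i" and "y = 2 * real_of_int j"
  have r: "real_of_int A = p + q * (x\<^sup>2 + y\<^sup>2 - 1) + s * x + t * y"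
    "real_of_int k1 = real_of_int A + 4 * q * (x + 1) + 2 * s"
    "real_of_int k2 = real_of_int A - 4 * q * (x - 1) - 2 * s"
    "real_of_int k3 = real_of_int A + 4 * q * (y + 1) + 2 * t"
    "real_of_int k4 = real_of_int A - 4 * q * (y - 1) - 2 * t"
    unfolding V[symmetric] by (simp_all add: \<phi> grid_value_def x_def y_def power2_eq_square algebra_simps)
  have sum: "P1 + P2 = P3 + P4"
  proof -
    have "real_of_int (P1 + P2) = of_int (P3 + P4)" unfolding Pdefs of_int_add r(2-5) by (simp add: algebra_simps)
    then show ?thesis by (simp only: of_int_eq_iff)
  qed
  have disc: "4 * P1 * P2 - (P3 - P4)\<^sup>2 = 16 * A\<^sup>2"
  proof -
    have "real_of_int (4 * P1 * P2 - (P3 - P4)\<^sup>2 - 16 * A\<^sup>2)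
      = 4 * (2 * of_int A + 4 * q * (x + 1) + 2 * s) * (2 * of_int A - 4 * q * (x - 1) - 2 * s)
        - (8 * q * y + 4 * t)\<^sup>2 - 16 * (of_int A)\<^sup>2"
      unfolding Pdefs by (simp add: r(2-5) algebra_simps)
    \<comment> \<open>The inner bracket vanishes by the formula for \<open>A\<close>, the remaining
      terms by isotropy.\<close>
    also have "\<dots> = 16 * (4 * q * (of_int A - (p + q * (x\<^sup>2 + y\<^sup>2 - 1) + s * x + t * y)) + 4 * p * q - (s\<^sup>2 + t\<^sup>2))"
      by (simp add: power2_eq_square algebra_simps)
    also have "\<dots> = 0" using iso r(1) by simp
    finally have "4 * P1 * P2 - (P3 - P4)\<^sup>2 - 16 * A\<^sup>2 = 0" by (simp only: of_int_eq_0_iff)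
    then show ?thesis by simp
  qed
  have prim: False if m: "prime m" "m dvd A" "m dvd P1" "m dvd P2" "m dvd P3" "m dvd P4" for m
  proof -
    have "m dvd k1" "m dvd k2" "m dvd k3" "m dvd k4" using m(2-6) unfolding Pdefs by (simp_all add: dvd_add_right_iff)
    then obtain l0 l1 l2 l3 l4 where l: "A = m * l0" "k1 = m * l1" "k2 = m * l2" "k3 = m * l3" "k4 = m * l4"
      using m(2) by (meson dvdE)
    have "grid_divisible m \<phi>"
      by (rule grid_divisibleI[of \<phi> i j m l0 l1 l2 l3 l4]) (simp_all only: V l)
    then show False using primitive_not_grid_divisible[OF assms(2) m(1) w] by blast
  qed
  have ex: "\<exists>P R K x y. (P, R, 2 * K) \<in> {(P1, P2, P3 - P4), (P3, P4, P1 - P2)} \<and>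
    coprime x y \<and> odd (x + y) \<and> coprime (P * x\<^sup>2 + 2 * K * x * y + R * y\<^sup>2) A"
    by (rule quadruple_form_value_coprime[OF sum disc]) (rule prim)
  obtain P R K x y where PRK: "(P, R, 2 * K) \<in> {(P1, P2, P3 - P4), (P3, P4, P1 - P2)}"
    and xy: "coprime x y" "odd (x + y)" "coprime (P * x\<^sup>2 + 2 * K * x * y + R * y\<^sup>2) A"
    using ex by (elim exE conjE) (rule that)
  have "form_at C (2 * i) (2 * j) A P K R"
    using PRK
  proof (elim insertE emptyE)
    assume e: "(P, R, 2 * K) = (P1, P2, P3 - P4)"
    then have "real_of_int (2 * K) = of_int (P3 - P4)" by simp
    then show ?thesis unfolding form_at_def using e w C V
      by (intro exI[of _ h] exI[of _ \<phi>] exI[of _ 1] exI[of _ 0] exI[of _ 0] exI[of _ 1]) (simp add: unit_frame_def Pdefs)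
  next
    assume e: "(P, R, 2 * K) = (P3, P4, P1 - P2)"
    then have "real_of_int (2 * K) = of_int (P1 - P2)" by simp
    then show ?thesis unfolding form_at_def using e w C V
      by (intro exI[of _ h] exI[of _ \<phi>] exI[of _ 0] exI[of _ 1] exI[of _ 1] exI[of _ 0]) (simp add: unit_frame_def Pdefs)
  qed
  from neighbour_curvatures[OF this _ _ xy(1,2)]
  obtain C' where C': "C' \<in> ?P" "tangent C C'"
    and abs: "\<bar>curvature ?P C'\<bar> = of_int \<bar>P * x\<^sup>2 + 2 * K * x * y + R * y\<^sup>2 - A\<bar>" by auto
  obtain b where b: "curvature ?P C' = of_int b"
    using assms(1) C'(1) unfolding is_integral_packing_def by (meson Ints_cases)
  have "\<bar>b\<bar> = \<bar>P * x\<^sup>2 + 2 * K * x * y + R * y\<^sup>2 - A\<bar>" using abs unfolding b by (simp only: of_int_abs[symmetric] of_int_eq_iff)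
  \<comment> \<open>The functional and \<open>curvature\<close> may disagree in sign at both
    circles; coprimality is insensitive to this.\<close>
  moreover have "\<bar>n\<bar> = \<bar>A\<bar>"
    using abs_curvature_word[OF w, of ?P "2 * i" "2 * j"] unfolding C assms(4) V
    by (simp only: of_int_abs[symmetric] of_int_eq_iff)
  moreover have "coprime A (P * x\<^sup>2 + 2 * K * x * y + R * y\<^sup>2 - A)"
  proof (rule coprimeI)
    fix e assume "e dvd A" "e dvd P * x\<^sup>2 + 2 * K * x * y + R * y\<^sup>2 - A"
    moreover then have "e dvd (P * x\<^sup>2 + 2 * K * x * y + R * y\<^sup>2 - A) + A" by (intro dvd_add)
    ultimately show "is_unit e" using xy(3) by (metis coprime_common_divisor diff_add_cancel)
  qed
  ultimately have "coprime \<bar>n\<bar> \<bar>b\<bar>" by simp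
  then have "coprime n b" by simp
  then show ?thesis using C' b by blast
qed

lemma curvature_zero_unbounded:
  assumes "C \<in> square_packing_of \<mu>" "curvature P C = 0"
  shows "None \<in> C"
proof -
  obtain h \<phi> i j where C: "C = (\<mu> \<circ> h) ` grid_circle (2 * i) (2 * j)" and w: "word base h \<phi>"
    using assms(1) unfolding packing_eq by blast
  have "grid_value \<phi> (2 * i) (2 * j) = 0"
    using abs_curvature_word[OF w, of P "2 * i" "2 * j"] assms(2) unfolding C by simp
  moreover obtain \<beta> \<gamma> where "C = circ (grid_value \<phi> (2 * i) (2 * j)) \<beta> \<gamma>"
    unfolding C by (rule represents_grid_circle[OF represents_word[OF w represents_base]])
  ultimately show ?thesis by (simp add: circ_def)
qed

end

lemma tangent_sym: "tangent C C' \<longleftrightarrow> tangent C' C"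
  unfolding tangent_def by (simp add: Int_commute)

theorem theorem5p15:
  fixes P :: "ext_plane set set"
  assumes "is_square_packing P"
    and "is_integral_packing P"
    and "is_primitive_packing P"
    and "(\<forall>k\<in>curvatures P. [k = 1] (mod 8)) \<or>
         ((\<exists>k\<in>curvatures P. odd k) \<and> (\<exists>k\<in>curvatures P. even k))"
    and "\<And>C C' a b. C \<in> P \<Longrightarrow> C' \<in> P \<Longrightarrow> tangent C C' \<Longrightarrow>
           curvature P C = of_int a \<Longrightarrow> curvature P C' = of_int b \<Longrightarrow>
           a \<noteq> 0 \<Longrightarrow> gcd a b = 1 \<Longrightarrow> chi a b = - 1"
  shows "\<not> (\<exists>C\<in>P. \<exists>n::int. curvature P C = of_int (n\<^sup>2))"
proof
  assume "\<exists>C\<in>P. \<exists>n::int. curvature P C = of_int (n\<^sup>2)"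
  then obtain C and n :: int where C: "C \<in> P" "curvature P C = of_int (n\<^sup>2)" by blast
  obtain a b c d where "a * d - b * c \<noteq> 0" and P0: "P = square_packing_of (moebius a b c d)"
    using assms(1) unfolding is_square_packing_def is_moebius_def by blast
  then interpret moebius_packing a b c d by unfold_locales
  have P: "P = square_packing_of \<mu>" unfolding P0 \<mu>_def ..
  obtain C' b' where C': "C' \<in> P" "tangent C C'" "curvature P C' = of_int b'" "coprime (n\<^sup>2) b'"
    using exists_coprime_tangent[of C "n\<^sup>2"] assms(2,3) C unfolding P by blast
  show False
  proof (cases "n = 0")
    case False
    then have "chi (n\<^sup>2) b' = - 1" using assms(5)[OF C(1) C'(1,2) C(2) C'(3)] C'(4) by simp
    then show False using chi_square[OF False C'(4)] by simp
  next
    case True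
    \<comment> \<open>Here \<open>C\<close> is a line, so no curvature is negative; the tangent
      curvature is coprime to 0 and therefore equals 1.\<close>
    then have "None \<in> C" using curvature_zero_unbounded[of C P] C P by simp
    then have "b' \<ge> 0" using curvature_nonneg[OF C(1), of C'] C'(3) by simp
    moreover have "\<bar>b'\<bar> = 1" using C'(4) True by simp
    ultimately have b': "b' = 1" by simp
    have "curvature P C' = of_int 1" "curvature P C = of_int 0" using C'(3) C(2) b' True by simp_all
    \<comment> \<open>The circles are exchanged so that the first curvature is nonzero; it is 1,
      again a square.\<close>
    then have "chi 1 0 = - 1" using assms(5)[OF C'(1) C(1)] C'(2) by (simp add: tangent_sym)
    then show False using chi_square[of 1 0] by simp
  qed
qed

end
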